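(* Let $d,n,m$ be positive integers, let $K\subset\mathbb{R}^d$ be compact, let $f_1,\ldots,f_m:K\to\mathbb{R}^n$ be Lebesgue integrable functions, let $\bar\theta=(\bar\theta_1,\ldots,\bar\theta_m)\in\mathcal{M}(K,\Delta_m)$, and set $$\alpha=\sum_{i=1}^m\int_K\bar\theta_i(x)f_i(x)\,dx\in\mathbb{R}^n,\qquad \mathcal{A}_\alpha=\Big\{\theta\in\mathcal{M}(K,\Delta_m)\ \Big|\ \sum_{i=1}^m\int_K\theta_i(x)f_i(x)\,dx=\alpha\Big\}.$$ For $v\in\mathcal{C}(K,\mathbb{R}^m)$ consider the problem of minimizing $$\int_K\theta(x)\cdot v(x)\,dx=\int_K\sum_{i=1}^m\theta_i(x)v_i(x)\,dx$$ over $\theta\in\mathcal{A}_\alpha$, and let $\mathcal{V}_\alpha$ be the set of all $v\in\mathcal{C}(K,\mathbb{R}^m)$ for which this minimization problem has a unique solution. Then $\mathcal{V}_\alpha$ is a residual subset of $\mathcal{C}(K,\mathbb{R}^m)$, i.e. it contains the intersection of countably many open dense subsets of $\mathcal{C}(K,\mathbb{R}^m)$. Moreover, for any $v\in\mathcal{V}_\alpha$, the unique optimal solution $\theta^*$ takes values in $\mathrm{Ext}(\Delta_m)$ almost everywhere in $K$.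
   Context: $\Delta_m=\{\zeta=(\zeta_1,\ldots,\zeta_m)\in\mathbb{R}^m\mid \zeta_i\ge 0\ \forall i=1,\ldots,m,\ \sum_{i=1}^m\zeta_i=1\}$ is the simplex of $\mathbb{R}^m$ and $\mathrm{Ext}(\Delta_m)$ is its set of extreme points. $\mathcal{M}(K,\Delta_m)$ is the set of Lebesgue measurable functions from $K$ to $\Delta_m$; functions that agree almost everywhere are identified (in particular, uniqueness of solutions is understood up to almost everywhere equality). $\mathcal{C}(K,\mathbb{R}^m)$ is the space of continuous functions from $K$ to $\mathbb{R}^m$ with the supremum norm. Measure and integrals are with respect to Lebesgue measure on $\mathbb{R}^d$. *)

theory Defs
  imports "HOL-Analysis.Analysis"
begin

definition std_simplex :: "(real ^ 'm) set"
  where "std_simplex = {\<zeta>. (\<forall>i. 0 \<le> \<zeta> $ i) \<and> (\<Sum>i\<in>UNIV. \<zeta> $ i) = 1}"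

(* Elements are functions, not almost-everywhere classes; the identification of functions that
   agree almost everywhere on K is made where uniqueness is expressed. Values off K are irrelevant. *)
definition meas_simplex :: "(real ^ 'd) set \<Rightarrow> (real ^ 'd \<Rightarrow> real ^ 'm) set"
  where "meas_simplex K =
    {\<theta>. \<theta> \<in> borel_measurable (lebesgue_on K) \<and> (\<forall>x\<in>K. \<theta> x \<in> std_simplex)}"

definition mixed_integral ::
  "(real ^ 'd) set \<Rightarrow> ('m::finite \<Rightarrow> real ^ 'd \<Rightarrow> real ^ 'n) \<Rightarrow> (real ^ 'd \<Rightarrow> real ^ 'm) \<Rightarrow> real ^ 'n"
  where "mixed_integral K f \<theta> = (\<Sum>i\<in>UNIV. \<integral>x. (\<theta> x $ i) *\<^sub>R f i x \<partial>lebesgue_on K)"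

definition admissible ::
  "(real ^ 'd) set \<Rightarrow> ('m::finite \<Rightarrow> real ^ 'd \<Rightarrow> real ^ 'n) \<Rightarrow> real ^ 'n \<Rightarrow> (real ^ 'd \<Rightarrow> real ^ 'm) set"
  where "admissible K f \<alpha> = {\<theta> \<in> meas_simplex K. mixed_integral K f \<theta> = \<alpha>}"

definition cost ::
  "(real ^ 'd) set \<Rightarrow> (real ^ 'd \<Rightarrow> real ^ 'm) \<Rightarrow> (real ^ 'd \<Rightarrow> real ^ 'm) \<Rightarrow> real"
  where "cost K v \<theta> = (\<integral>x. \<theta> x \<bullet> v x \<partial>lebesgue_on K)"

definition is_solution ::
  "(real ^ 'd) set \<Rightarrow> ('m::finite \<Rightarrow> real ^ 'd \<Rightarrow> real ^ 'n) \<Rightarrow> real ^ 'n \<Rightarrow> (real ^ 'd \<Rightarrow> real ^ 'm)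
    \<Rightarrow> (real ^ 'd \<Rightarrow> real ^ 'm) \<Rightarrow> bool"
  where "is_solution K f \<alpha> v \<theta> \<longleftrightarrow>
    \<theta> \<in> admissible K f \<alpha> \<and> (\<forall>\<eta>\<in>admissible K f \<alpha>. cost K v \<theta> \<le> cost K v \<eta>)"

(* C(K, R^m) with the supremum metric; its elements are extensional, i.e. undefined off K. *)
definition cont_space :: "(real ^ 'd) set \<Rightarrow> (real ^ 'd \<Rightarrow> real ^ 'm) metric"
  where "cont_space K = cfunspace (top_of_set K) euclidean_metric"

definition uniquely_solvable ::
  "(real ^ 'd) set \<Rightarrow> ('m::finite \<Rightarrow> real ^ 'd \<Rightarrow> real ^ 'n) \<Rightarrow> real ^ 'n \<Rightarrow> (real ^ 'd \<Rightarrow> real ^ 'm) set"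
  where "uniquely_solvable K f \<alpha> = {v \<in> mspace (cont_space K).
    \<exists>\<theta>. is_solution K f \<alpha> v \<theta> \<and>
      (\<forall>\<eta>. is_solution K f \<alpha> v \<eta> \<longrightarrow> (AE x in lebesgue_on K. \<eta> x = \<theta> x))}"

definition residual_in :: "'a topology \<Rightarrow> 'a set \<Rightarrow> bool"
  where "residual_in X S \<longleftrightarrow> S \<subseteq> topspace X \<and>
    (\<exists>\<U>. countable \<U> \<and> (\<forall>U\<in>\<U>. openin X U \<and> X closure_of U = topspace X)
      \<and> topspace X \<inter> \<Inter>\<U> \<subseteq> S)"

end

theory Submission
  imports Defs
begin

text \<open>
  The optimal value \<open>J(v)\<close>, the infimum of the cost over the admissible controls, is a concave
  Lipschitz function of \<open>v\<close>, and every optimal control for \<open>v\<close> is a supergradient of \<open>J\<close> at \<open>v\<close>.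
  As in Mazur's theorem, \<open>J\<close> is generically differentiable in each direction of a countable family;
  if the family separates integrable functions, then the supergradient, hence the optimal control,
  is unique at such points. Extremality is Lyapunov's argument: if two components of an optimal
  control are positive on a set of positive measure, mass can be moved to and fro between them
  without changing the constraint, which yields a second optimal control.
\<close>

section \<open>Separation by countably many continuous functions\<close>

text \<open>Differentiability of J is a limit statement, and a set defined by limits is not
  obviously a countable intersection of open sets. It is therefore replaced by a condition with a
  single witness: for given w and \<epsilon> some t > 0 satisfies J(v + t w) + J(v - t w) - 2 J(v) >
  -\<epsilon> t. For fixed t this is open in v, since J is Lipschitz, and one such t already forces
  any two optimal controls for v to have costs against w that differ by less than \<epsilon>. Taking
  \<epsilon> = 1 / (n + 1) makes these costs equal. The directions w must be continuous, so that v +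
  t w is again a cost, and countable in number, so that only countably many sets are intersected;
  functions g times a unit vector serve, with g from a countable family of continuous functions. In
  the extremality half the cost is not among the constraints imposed on the perturbation:
  feasibility in both directions makes its first-order change vanish.\<close>

lemma borel_measurable_lebesgue_onI:
  "p \<in> borel_measurable borel \<Longrightarrow> p \<in> borel_measurable (lebesgue_on S)"
  by (auto intro!: measurable_restrict_space1 measurable_completion)

text \<open>The set where \<open>h\<close> is positive is only Lebesgue measurable, so the
  hypothesis is first carried over from Borel sets, which differ from Lebesgue sets by null sets.
  The integral of \<open>h\<close> over that set is then 0, so the set is null; the same applies to
  \<open>- h\<close>.\<close>

lemma integral_borel_eq_0_imp_AE_eq_0:
  fixes h :: "'a::euclidean_space \<Rightarrow> real"
  assumes S: "S \<in> sets lebesgue" and h: "integrable (lebesgue_on S) h"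
    and 0: "\<And>A. A \<in> sets borel \<Longrightarrow> (\<integral>x. indicator A x * h x \<partial>lebesgue_on S) = 0"
  shows "AE x in lebesgue_on S. h x = 0"
proof -
  have leb0: "(\<integral>x. indicator A x * h x \<partial>lebesgue_on S) = 0" if A: "A \<in> sets lebesgue" for A
  proof -
    obtain B N N' where B: "A = B \<union> N" "N \<subseteq> N'" "N' \<in> null_sets lborel" "B \<in> sets lborel"
      using A by (rule sets_completionE) auto
    have "N' \<in> null_sets lebesgue"
      using B(3) null_sets_completionI by blast
    then have "AE x in lebesgue. x \<notin> N'"
      by (rule AE_not_in)
    then have N': "AE x in lebesgue_on S. x \<notin> N'"
      using S by (subst AE_restrict_space_iff) auto
    have "(\<integral>x. indicator A x * h x \<partial>lebesgue_on S) = (\<integral>x. indicator B x * h x \<partial>lebesgue_on S)"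
    proof (rule integral_cong_AE)
      show "(\<lambda>x. indicator A x * h x) \<in> borel_measurable (lebesgue_on S)"
        "(\<lambda>x. indicator B x * h x) \<in> borel_measurable (lebesgue_on S)"
        using A B(4) h
        by (auto intro!: borel_measurable_times intro: measurable_restrict_space1 borel_measurable_lebesgue_onI)
      show "AE x in lebesgue_on S. indicator A x * h x = indicator B x * h x"
        using N' by eventually_elim (use B in \<open>auto simp: indicator_def\<close>)
    qed
    then show ?thesis
      using 0[of B] B(4) by simp
  qed
  have *: "AE x in lebesgue_on S. \<not> 0 < g x"
    if g: "integrable (lebesgue_on S) g" and g0: "\<And>A. A \<in> sets lebesgue \<Longrightarrow> (\<integral>x. indicator A x * g x \<partial>lebesgue_on S) = 0"
    for g :: "'a \<Rightarrow> real"
  proof -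
    define P where "P = {x \<in> space (lebesgue_on S). 0 < g x}"
    have "P \<in> sets (lebesgue_on S)"
      unfolding P_def using g by measurable
    then have P: "P \<in> sets lebesgue"
      using S by (simp add: sets_restrict_space_iff)
    have "AE x in lebesgue_on S. indicator P x * g x = 0"
    proof (subst integral_nonneg_eq_0_iff_AE[symmetric])
      show "integrable (lebesgue_on S) (\<lambda>x. indicator P x * g x)"
        using P g by (intro integrable_real_mult_indicator[of P, simplified mult.commute[of _ "indicator P _"]])
          (auto simp: sets_restrict_space_iff S P_def)
      show "AE x in lebesgue_on S. 0 \<le> indicator P x * g x"
        by (auto simp: P_def indicator_def)
    qed (use g0 P in auto)
    then show ?thesis
      using AE_space by eventually_elim (auto simp: P_def indicator_def split: if_splits)
  qed
  have "AE x in lebesgue_on S. \<not> 0 < h x"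
    using * h leb0 by blast
  moreover have "AE x in lebesgue_on S. \<not> 0 < - h x"
    using h leb0 by (intro *) auto
  ultimately show ?thesis
    by eventually_elim auto
qed

text \<open>Dynkin's argument: the Borel sets are generated by a countable family of open sets
  stable under intersection, and the indicator of an open set is a pointwise limit of continuous
  functions. Vanishing integrals pass to these indicators by dominated convergence, and from there
  to all Borel sets through complements and disjoint unions.\<close>

lemma countable_separating_continuous:
  fixes S :: "'a::euclidean_space set"
  assumes S: "S \<in> sets lebesgue"
  shows "\<exists>G :: ('a \<Rightarrow> real) set. countable G \<and> (\<forall>g\<in>G. continuous_on UNIV g) \<and>
    (\<forall>h. integrable (lebesgue_on S) h \<longrightarrow> (\<forall>g\<in>G. (\<integral>x. g x * h x \<partial>lebesgue_on S) = 0)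
      \<longrightarrow> (AE x in lebesgue_on S. h x = 0))"
proof -
  obtain B :: "'a set set" where B: "countable B" "topological_basis B"
    using ex_countable_basis by blast
  \<comment> \<open>Closing the basis under finite intersections makes it Int-stable and keeps it
    countable; the empty intersection contributes \<open>UNIV\<close>, from which complements are
    subtracted.\<close>
  define C where "C = Inter ` {F. finite F \<and> F \<subseteq> B}"
  have "countable C"
    unfolding C_def using B(1) by (intro countable_image countable_Collect_finite_subset)
  have openC: "open U" if "U \<in> C" for U
    using that B(2) by (auto simp: C_def intro!: open_Inter dest: topological_basis_open)
  have "B \<subseteq> C"
  proof
    fix b assume "b \<in> B" then show "b \<in> C"
      unfolding C_def by (intro image_eqI[of _ _ "{b}"]) auto
  qed
  have "topological_basis C"
    unfolding topological_basis_def
  proof safe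
    fix x :: "'a set" assume "open x"
    then show "\<exists>B'\<subseteq>C. \<Union> B' = x"
      using B(2) \<open>B \<subseteq> C\<close> unfolding topological_basis_def by (meson order_trans)
  qed (use openC in blast)
  have Int: "Int_stable C"
  proof (rule Int_stableI)
    fix a b assume "a \<in> C" "b \<in> C"
    then obtain F F' where "finite F" "F \<subseteq> B" "a = \<Inter>F" "finite F'" "F' \<subseteq> B" "b = \<Inter>F'"
      by (auto simp: C_def)
    then show "a \<inter> b \<in> C"
      unfolding C_def by (intro image_eqI[of _ _ "F \<union> F'"]) auto
  qed
  have UC: "UNIV \<in> C"
    unfolding C_def by (intro image_eqI[of _ _ "{}"]) auto
  \<comment> \<open>\<open>U = UNIV\<close> is a separate case because \<open>infdist x {}\<close>
    is 0, so the general formula would converge to 0 instead of 1.\<close>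
  define g where "g = (\<lambda>(U, n) (x::'a). if U = UNIV then 1 else min 1 (real n * infdist x (- U)))"
  have g: "g (U, n) x = (if U = UNIV then 1 else min 1 (real n * infdist x (- U)))" for U n x
    by (simp add: g_def)
  define G where "G = g ` (C \<times> UNIV)"
  have cont: "continuous_on UNIV \<gamma>" if \<gamma>: "\<gamma> \<in> G" for \<gamma>
  proof -
    obtain U n where "\<gamma> = g (U, n)" using \<gamma> unfolding G_def by force
    then show ?thesis
      unfolding g_def by (cases "U = UNIV") (auto intro!: continuous_intros)
  qed
  have vanish: "AE x in lebesgue_on S. h x = 0"
    if h: "integrable (lebesgue_on S) h" and 0: "\<And>\<gamma>. \<gamma> \<in> G \<Longrightarrow> (\<integral>x. \<gamma> x * h x \<partial>lebesgue_on S) = 0" for h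
  proof -
    have meash: "(\<lambda>x. p x * h x) \<in> borel_measurable (lebesgue_on S)"
      if "p \<in> borel_measurable borel" for p
      using h that by (auto intro!: borel_measurable_times intro: borel_measurable_lebesgue_onI)
    have ind: "integrable (lebesgue_on S) (\<lambda>x. indicator A x * h x)" if "A \<in> sets borel" for A
    proof (rule Bochner_Integration.integrable_bound[OF h])
      show "(\<lambda>x. indicator A x * h x) \<in> borel_measurable (lebesgue_on S)"
        using that by (intro meash) auto
    qed (auto simp: indicator_def)
    have C0: "(\<integral>x. indicator U x * h x \<partial>lebesgue_on S) = 0" if U: "U \<in> C" for U
    proof -
      have gn: "g (U, n) \<in> G" for n using U by (auto simp: G_def)
      have lim: "(\<lambda>n. g (U, n) x) \<longlonglongrightarrow> indicator U x" for x
      proof (cases "U = UNIV \<or> x \<notin> U")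
        case True
        then have "g (U, n) x = indicator U x" for n
          by (auto simp: g)
        then show ?thesis by simp
      next
        case False
        then have "0 < infdist x (- U)"
          using openC[OF U] by (intro infdist_pos_not_in_closed) auto
        then obtain N where N: "1 < real N * infdist x (- U)"
          using reals_Archimedean3 by blast
        have "\<forall>\<^sub>F n in sequentially. g (U, n) x = 1"
          unfolding eventually_sequentially
        proof (intro exI[of _ N] allI impI)
          fix n assume "N \<le> n"
          then have "real N * infdist x (- U) \<le> real n * infdist x (- U)"
            by (intro mult_right_mono) (auto simp: infdist_nonneg)
          with N show "g (U, n) x = 1"
            by (auto simp: g)
        qed
        then show ?thesis
          using False by (simp add: tendsto_eventually)
      qed
      have "(\<lambda>n. \<integral>x. g (U, n) x * h x \<partial>lebesgue_on S) \<longlonglongrightarrow> (\<integral>x. indicator U x * h x \<partial>lebesgue_on S)"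
      proof (rule integral_dominated_convergence[where w = "\<lambda>x. norm (h x)"])
        show "(\<lambda>x. indicator U x * h x) \<in> borel_measurable (lebesgue_on S)"
          using openC[OF U] by (intro meash) auto
        show "(\<lambda>x. g (U, n) x * h x) \<in> borel_measurable (lebesgue_on S)" for n
          using cont[OF gn] by (intro meash) (auto intro: borel_measurable_continuous_onI)
        show "AE x in lebesgue_on S. (\<lambda>n. g (U, n) x * h x) \<longlonglongrightarrow> indicator U x * h x"
          by (intro AE_I2 tendsto_intros lim)
        have "\<bar>g (U, n) x\<bar> \<le> 1" for n x
          by (auto simp: g infdist_nonneg abs_le_iff min_def intro: order_trans[of _ 0])
        then show "AE x in lebesgue_on S. norm (g (U, n) x * h x) \<le> norm (h x)" for n
          by (auto simp: abs_mult intro!: AE_I2 mult_left_le_one_le)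
      qed (use h in auto)
      then show ?thesis
        using 0[OF gn] by (simp add: LIMSEQ_const_iff)
    qed
    show ?thesis
    proof (rule integral_borel_eq_0_imp_AE_eq_0[OF S h])
      fix A :: "'a set" assume A: "A \<in> sets borel"
      have borel: "sets borel = sigma_sets UNIV C"
        by (subst borel_eq_countable_basis[OF \<open>countable C\<close> \<open>topological_basis C\<close>])
          (simp add: sets_measure_of)
      note Int
      moreover have "C \<subseteq> Pow UNIV" by simp
      moreover from A have "A \<in> sigma_sets UNIV C" by (simp add: borel)
      ultimately show "(\<integral>x. indicator A x * h x \<partial>lebesgue_on S) = 0"
      proof (induction rule: sigma_sets_induct_disjoint)
        case (compl A)
        have "(\<integral>x. indicator (UNIV - A) x * h x \<partial>lebesgue_on S)
          = (\<integral>x. indicator UNIV x * h x - indicator A x * h x \<partial>lebesgue_on S)"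
          by (intro Bochner_Integration.integral_cong) (auto simp: indicator_def)
        also have "\<dots> = 0"
          using compl C0[OF UC] ind[of A] h by (simp add: borel)
        finally show ?case .
      next
        case (union A)
        have meas: "A i \<in> sets borel" for i using union by (auto simp: borel)
        have pd: "(\<lambda>n. \<Sum>i<n. indicator (A i) x * h x) \<longlonglongrightarrow> indicator (\<Union>i. A i) x * h x" for x
          using sums_mult2[OF indicator_sums[of A x], of "h x"] union(1)
          by (auto simp: sums_def disjoint_family_on_def)
        have bd: "norm (\<Sum>i<n. indicator (A i) x * h x) \<le> norm (h x)" for n x
        proof -
          have "(\<Sum>i<n. indicator (A i) x * h x) = indicator (\<Union>i<n. A i) x * h x"
            using union(1) by (subst indicator_UN_disjoint)
              (auto simp: disjoint_family_on_def sum_distrib_right)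
          then show ?thesis by (auto simp: indicator_def)
        qed
        have "(\<lambda>n. \<integral>x. (\<Sum>i<n. indicator (A i) x * h x) \<partial>lebesgue_on S)
           \<longlonglongrightarrow> (\<integral>x. indicator (\<Union>i. A i) x * h x \<partial>lebesgue_on S)"
        proof (rule integral_dominated_convergence[where w = "\<lambda>x. norm (h x)"])
          show "(\<lambda>x. indicator (\<Union>i. A i) x * h x) \<in> borel_measurable (lebesgue_on S)"
            using meas by (intro meash) auto
          show "(\<lambda>x. \<Sum>i<n. indicator (A i) x * h x) \<in> borel_measurable (lebesgue_on S)" for n
            using meas by (intro borel_measurable_sum meash) auto
        qed (use h bd pd in \<open>simp_all add: AE_I2\<close>)
        moreover have "(\<integral>x. (\<Sum>i<n. indicator (A i) x * h x) \<partial>lebesgue_on S) = 0" for n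
          using union(3) by (subst Bochner_Integration.integral_sum) (auto intro: ind meas)
        ultimately show ?case
          by (simp add: LIMSEQ_const_iff)
      qed (use C0 in auto)
    qed
  qed
  have "countable G"
    unfolding G_def using \<open>countable C\<close> by auto
  then show ?thesis
    by (intro exI[of _ G] conjI ballI allI impI cont vanish) auto
qed

section \<open>Controls with values in the simplex\<close>

lemma std_simplex_component:
  assumes "\<zeta> \<in> std_simplex" shows "0 \<le> \<zeta> $ i" "\<zeta> $ i \<le> 1"
proof -
  show "0 \<le> \<zeta> $ i" using assms by (simp add: std_simplex_def)
  have "\<zeta> $ i \<le> (\<Sum>j\<in>UNIV. \<zeta> $ j)"
    using assms by (intro member_le_sum) (auto simp: std_simplex_def)
  then show "\<zeta> $ i \<le> 1" using assms by (simp add: std_simplex_def)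
qed

lemma norm_std_simplex_le_1: "\<zeta> \<in> std_simplex \<Longrightarrow> norm \<zeta> \<le> 1"
  using norm_le_l1_cart[of \<zeta>] by (simp add: std_simplex_def)

lemma std_simplex_midpoint:
  assumes "\<zeta> \<in> std_simplex" "\<xi> \<in> std_simplex"
  shows "(1/2) *\<^sub>R (\<zeta> + \<xi>) \<in> std_simplex"
  using assms by (auto simp: std_simplex_def sum.distrib simp flip: sum_divide_distrib)

lemma closed_std_simplex: "closed (std_simplex :: (real ^ 'm) set)"
proof -
  have "std_simplex = (\<Inter>i. {\<zeta>. 0 \<le> \<zeta> $ i}) \<inter> {\<zeta> :: real ^ 'm. (\<Sum>i\<in>UNIV. \<zeta> $ i) = 1}"
    by (auto simp: std_simplex_def)
  show ?thesis
    unfolding \<open>std_simplex = _\<close>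
    by (intro closed_Int closed_INT ballI closed_Collect_le closed_Collect_eq continuous_intros)
qed

lemma borel_measurable_vec_nth [measurable (raw)]:
  fixes \<theta> :: "'a \<Rightarrow> real ^ 'm"
  assumes "\<theta> \<in> borel_measurable M" shows "(\<lambda>x. \<theta> x $ i) \<in> borel_measurable M"
  using borel_measurable_continuous_on[OF _ assms, of "\<lambda>v. v $ i"]
  by (simp add: continuous_on_component)

lemma borel_measurable_continuous_lebesgue_on:
  fixes v :: "'a::euclidean_space \<Rightarrow> 'b::euclidean_space"
  assumes "compact K" "continuous_on K v" shows "v \<in> borel_measurable (lebesgue_on K)"
  using assms by (intro continuous_imp_measurable_on_sets_lebesgue) (auto intro: fmeasurableD lmeasurable_compact)

lemma meas_simplex_measurable: "\<theta> \<in> meas_simplex K \<Longrightarrow> \<theta> \<in> borel_measurable (lebesgue_on K)"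
  by (simp add: meas_simplex_def)

lemma meas_simplex_in_simplex: "\<theta> \<in> meas_simplex K \<Longrightarrow> x \<in> K \<Longrightarrow> \<theta> x \<in> std_simplex"
  by (simp add: meas_simplex_def)

lemma meas_simplex_midpoint:
  assumes "\<theta> \<in> meas_simplex K" "\<eta> \<in> meas_simplex K"
  shows "(\<lambda>x. (1/2) *\<^sub>R (\<theta> x + \<eta> x)) \<in> meas_simplex K"
  using assms unfolding meas_simplex_def
  by (auto intro: std_simplex_midpoint simp del: scaleR_add_right)

section \<open>Integrals of simplex-valued controls over a compact set\<close>

context
  fixes K :: "(real ^ 'd) set"
  assumes K: "compact K"
begin

lemma finite_measure_on_compact: "finite_measure (lebesgue_on K)"
  using K by (intro finite_measure_lebesgue_on lmeasurable_compact)

lemma integrable_bounded_on_compact: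
  fixes g :: "real ^ 'd \<Rightarrow> 'b::{banach, second_countable_topology}"
  assumes "g \<in> borel_measurable (lebesgue_on K)" "\<And>x. x \<in> K \<Longrightarrow> norm (g x) \<le> B"
  shows "integrable (lebesgue_on K) g"
  by (rule finite_measure.integrable_const_bound[OF finite_measure_on_compact AE_I2[of _ _]])
    (use assms in auto)

lemma integrable_bounded_inner:
  fixes \<theta> v :: "real ^ 'd \<Rightarrow> real ^ 'm"
  assumes \<theta>: "\<theta> \<in> borel_measurable (lebesgue_on K)" "\<And>x. x \<in> K \<Longrightarrow> norm (\<theta> x) \<le> C"
    and v: "continuous_on K v"
  shows "integrable (lebesgue_on K) (\<lambda>x. \<theta> x \<bullet> v x)"
proof -
  obtain B where B: "\<And>x. x \<in> K \<Longrightarrow> norm (v x) \<le> B"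
    using compact_imp_bounded[OF compact_continuous_image[OF v K]] by (auto simp: bounded_iff)
  show ?thesis
  proof (rule integrable_bounded_on_compact)
    show "(\<lambda>x. \<theta> x \<bullet> v x) \<in> borel_measurable (lebesgue_on K)"
      using \<theta>(1) borel_measurable_continuous_lebesgue_on[OF K v] by measurable
    show "norm (\<theta> x \<bullet> v x) \<le> C * B" if "x \<in> K" for x
      using that \<theta>(2) B unfolding real_norm_def
      by (intro order_trans[OF Cauchy_Schwarz_ineq2] mult_mono) (auto intro: order_trans[OF norm_ge_zero])
  qed
qed

lemma integrable_cost:
  "\<theta> \<in> meas_simplex K \<Longrightarrow> continuous_on K v \<Longrightarrow> integrable (lebesgue_on K) (\<lambda>x. \<theta> x \<bullet> v x)"
  by (rule integrable_bounded_inner[of _ 1])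
    (auto intro: meas_simplex_measurable norm_std_simplex_le_1 meas_simplex_in_simplex)

lemma integrable_bounded_scaleR:
  fixes p :: "real ^ 'd \<Rightarrow> real ^ 'n"
  assumes p: "integrable (lebesgue_on K) p"
    and u: "u \<in> borel_measurable (lebesgue_on K)" "\<And>x. x \<in> K \<Longrightarrow> \<bar>u x\<bar> \<le> B"
  shows "integrable (lebesgue_on K) (\<lambda>x. u x *\<^sub>R p x)"
proof (rule Bochner_Integration.integrable_bound)
  show "integrable (lebesgue_on K) (\<lambda>x. B * norm (p x))" using p by auto
  show "(\<lambda>x. u x *\<^sub>R p x) \<in> borel_measurable (lebesgue_on K)" using p u by auto
  show "AE x in lebesgue_on K. norm (u x *\<^sub>R p x) \<le> norm (B * norm (p x))"
    using u(2) by (auto simp: abs_mult intro!: AE_I2 mult_right_mono intro: order_trans[OF _ abs_ge_self])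
qed

lemma integrable_meas_simplex_scaleR:
  fixes p :: "real ^ 'd \<Rightarrow> real ^ 'n"
  assumes p: "integrable (lebesgue_on K) p" and \<theta>: "\<theta> \<in> meas_simplex K"
  shows "integrable (lebesgue_on K) (\<lambda>x. (\<theta> x $ i) *\<^sub>R p x)"
proof (rule integrable_bounded_scaleR[OF p, of _ 1])
  show "\<bar>\<theta> x $ i\<bar> \<le> 1" if "x \<in> K" for x
    using std_simplex_component[OF meas_simplex_in_simplex[OF \<theta> that], of i] by auto
qed (use meas_simplex_measurable[OF \<theta>] in measurable)

lemma mixed_integral_midpoint:
  assumes f: "\<And>i. integrable (lebesgue_on K) (f i)"
    and "\<theta> \<in> meas_simplex K" "\<eta> \<in> meas_simplex K"
  shows "mixed_integral K f (\<lambda>x. (1/2) *\<^sub>R (\<theta> x + \<eta> x))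
    = (1/2) *\<^sub>R (mixed_integral K f \<theta> + mixed_integral K f \<eta>)"
proof -
  have "(\<integral>x. (((1/2) *\<^sub>R (\<theta> x + \<eta> x)) $ i) *\<^sub>R f i x \<partial>lebesgue_on K)
     = (1/2) *\<^sub>R ((\<integral>x. (\<theta> x $ i) *\<^sub>R f i x \<partial>lebesgue_on K) + (\<integral>x. (\<eta> x $ i) *\<^sub>R f i x \<partial>lebesgue_on K))" for i
  proof -
    have "(\<integral>x. (((1/2) *\<^sub>R (\<theta> x + \<eta> x)) $ i) *\<^sub>R f i x \<partial>lebesgue_on K)
       = (\<integral>x. (1/2) *\<^sub>R ((\<theta> x $ i) *\<^sub>R f i x + (\<eta> x $ i) *\<^sub>R f i x) \<partial>lebesgue_on K)"
      by (simp add: scaleR_add_left scaleR_add_right add_divide_distrib)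
    also have "\<dots> = (1/2) *\<^sub>R ((\<integral>x. (\<theta> x $ i) *\<^sub>R f i x \<partial>lebesgue_on K) + (\<integral>x. (\<eta> x $ i) *\<^sub>R f i x \<partial>lebesgue_on K))"
      using assms by (subst integral_scaleR_right)
        (simp_all add: Bochner_Integration.integral_add integrable_meas_simplex_scaleR)
    finally show ?thesis .
  qed
  then show ?thesis
    unfolding mixed_integral_def by (simp only: sum.distrib flip: scaleR_sum_right)
qed

lemma cost_midpoint:
  assumes "continuous_on K v" "\<theta> \<in> meas_simplex K" "\<eta> \<in> meas_simplex K"
  shows "cost K v (\<lambda>x. (1/2) *\<^sub>R (\<theta> x + \<eta> x)) = (cost K v \<theta> + cost K v \<eta>) / 2"
  using integrable_cost[OF assms(2,1)] integrable_cost[OF assms(3,1)]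
  by (simp add: cost_def inner_add_left Bochner_Integration.integral_add add_divide_distrib)

text \<open>Controls have norm at most 1, so Cauchy-Schwarz bounds the integrand by
  \<open>B\<close>. This is the origin of the Lipschitz constant \<open>measure lebesgue K\<close>
  of the optimal value.\<close>

lemma cost_diff_le:
  assumes v: "continuous_on K v" "continuous_on K w" and \<theta>: "\<theta> \<in> meas_simplex K"
    and B: "\<And>x. x \<in> K \<Longrightarrow> norm (v x - w x) \<le> B"
  shows "\<bar>cost K v \<theta> - cost K w \<theta>\<bar> \<le> B * measure lebesgue K"
proof -
  have vw: "continuous_on K (\<lambda>x. v x - w x)" using v by (intro continuous_intros)
  have "cost K v \<theta> - cost K w \<theta> = (\<integral>x. \<theta> x \<bullet> (v x - w x) \<partial>lebesgue_on K)"
    using integrable_cost[OF \<theta> v(1)] integrable_cost[OF \<theta> v(2)] by (simp add: cost_def inner_diff_right)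
  also have "\<bar>\<dots>\<bar> \<le> (\<integral>x. norm (\<theta> x \<bullet> (v x - w x)) \<partial>lebesgue_on K)"
    using integral_norm_bound[of "lebesgue_on K" "\<lambda>x. \<theta> x \<bullet> (v x - w x)"] by simp
  also have "\<dots> \<le> (\<integral>x. B \<partial>lebesgue_on K)"
  proof (rule integral_mono)
    show "integrable (lebesgue_on K) (\<lambda>x. norm (\<theta> x \<bullet> (v x - w x)))"
      using integrable_cost[OF \<theta> vw] by auto
    show "integrable (lebesgue_on K) (\<lambda>x. B)"
      using finite_measure.integrable_const[OF finite_measure_on_compact] .
    show "norm (\<theta> x \<bullet> (v x - w x)) \<le> B" if "x \<in> space (lebesgue_on K)" for x
    proof -
      from that have x: "x \<in> K" by simp
      have "norm (\<theta> x \<bullet> (v x - w x)) \<le> norm (\<theta> x) * norm (v x - w x)"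
        by (simp add: Cauchy_Schwarz_ineq2)
      also have "\<dots> \<le> 1 * B"
        using norm_std_simplex_le_1[OF meas_simplex_in_simplex[OF \<theta> x]] B[OF x] by (intro mult_mono) auto
      finally show ?thesis by simp
    qed
  qed
  also have "\<dots> = B * measure lebesgue K"
    using K by (simp add: measure_restrict_space lmeasurable_compact fmeasurableD)
  finally show ?thesis .
qed

lemma cost_tendsto_AE:
  assumes v: "continuous_on K v" and \<theta>: "\<And>n. \<theta>s n \<in> meas_simplex K" "\<theta> \<in> meas_simplex K"
    and lim: "AE x in lebesgue_on K. (\<lambda>n. \<theta>s n x) \<longlonglongrightarrow> \<theta> x"
  shows "(\<lambda>n. cost K v (\<theta>s n)) \<longlonglongrightarrow> cost K v \<theta>"
  unfolding cost_def
proof (rule integral_dominated_convergence[where w = "\<lambda>x. norm (v x)"])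
  show "(\<lambda>x. \<theta> x \<bullet> v x) \<in> borel_measurable (lebesgue_on K)"
    "(\<lambda>x. \<theta>s n x \<bullet> v x) \<in> borel_measurable (lebesgue_on K)" for n
    using integrable_cost[OF \<theta>(1) v] integrable_cost[OF \<theta>(2) v] by auto
  obtain B where B: "\<And>x. x \<in> K \<Longrightarrow> norm (v x) \<le> B"
    using compact_imp_bounded[OF compact_continuous_image[OF v K]] by (auto simp: bounded_iff)
  show "integrable (lebesgue_on K) (\<lambda>x. norm (v x))"
    using borel_measurable_continuous_lebesgue_on[OF K v] B
    by (intro integrable_norm integrable_bounded_on_compact)
  show "AE x in lebesgue_on K. (\<lambda>n. \<theta>s n x \<bullet> v x) \<longlonglongrightarrow> \<theta> x \<bullet> v x"
    using lim by eventually_elim (intro tendsto_intros)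
  show "AE x in lebesgue_on K. norm (\<theta>s n x \<bullet> v x) \<le> norm (v x)" for n
  proof (rule AE_I2)
    fix x assume "x \<in> space (lebesgue_on K)"
    then have "norm (\<theta>s n x) \<le> 1"
      using norm_std_simplex_le_1[OF meas_simplex_in_simplex[OF \<theta>(1)]] by simp
    then show "norm (\<theta>s n x \<bullet> v x) \<le> norm (v x)"
      using Cauchy_Schwarz_ineq2[of "\<theta>s n x" "v x"] mult_right_mono[of "norm (\<theta>s n x)" 1 "norm (v x)"]
      by simp
  qed
qed

text \<open>The components of a control lie between 0 and 1, so the integrable function
  \<open>norm (f i x)\<close> dominates and \<open>f\<close> may be unbounded.\<close>

lemma mixed_integral_tendsto_AE:
  assumes f: "\<And>i. integrable (lebesgue_on K) (f i)"
    and \<theta>: "\<And>n. \<theta>s n \<in> meas_simplex K" "\<theta> \<in> meas_simplex K"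
    and lim: "AE x in lebesgue_on K. (\<lambda>n. \<theta>s n x) \<longlonglongrightarrow> \<theta> x"
  shows "(\<lambda>n. mixed_integral K f (\<theta>s n)) \<longlonglongrightarrow> mixed_integral K f \<theta>"
  unfolding mixed_integral_def
proof (intro tendsto_sum integral_dominated_convergence[where w = "\<lambda>x. norm (f i x)" for i])
  fix i
  show "(\<lambda>x. (\<theta> x $ i) *\<^sub>R f i x) \<in> borel_measurable (lebesgue_on K)"
    "(\<lambda>x. (\<theta>s n x $ i) *\<^sub>R f i x) \<in> borel_measurable (lebesgue_on K)" for n
    using integrable_meas_simplex_scaleR[OF f \<theta>(1)] integrable_meas_simplex_scaleR[OF f \<theta>(2)] by auto
  show "integrable (lebesgue_on K) (\<lambda>x. norm (f i x))" using f by auto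
  show "AE x in lebesgue_on K. (\<lambda>n. (\<theta>s n x $ i) *\<^sub>R f i x) \<longlonglongrightarrow> (\<theta> x $ i) *\<^sub>R f i x"
    using lim by eventually_elim (intro tendsto_intros)
  show "AE x in lebesgue_on K. norm ((\<theta>s n x $ i) *\<^sub>R f i x) \<le> norm (f i x)" for n
    using std_simplex_component[OF meas_simplex_in_simplex[OF \<theta>(1)]]
    by (intro AE_I2) (auto intro!: mult_left_le_one_le)
qed

end

section \<open>Existence of optimal controls\<close>

context
  fixes K :: "(real ^ 'd) set"
  assumes K: "compact K"
begin

lemma abs_cost_le:
  fixes v :: "real ^ 'd \<Rightarrow> real ^ 'm"
  assumes "continuous_on K v" "\<theta> \<in> meas_simplex K" "\<And>x. x \<in> K \<Longrightarrow> norm (v x) \<le> B"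
  shows "\<bar>cost K v \<theta>\<bar> \<le> B * measure lebesgue K"
  using cost_diff_le[OF K assms(1) continuous_on_const[of K 0] assms(2)] assms(3)
  by (simp add: cost_def)

lemma bdd_below_cost:
  fixes v :: "real ^ 'd \<Rightarrow> real ^ 'm"
  assumes v: "continuous_on K v"
  shows "bdd_below (cost K v ` admissible K f \<alpha>)"
proof -
  obtain B where B: "\<And>x. x \<in> K \<Longrightarrow> norm (v x) \<le> B"
    using compact_imp_bounded[OF compact_continuous_image[OF v K]] by (auto simp: bounded_iff)
  show ?thesis
  proof (rule bdd_belowI2)
    fix \<theta> assume "\<theta> \<in> admissible K f \<alpha>"
    then show "- (B * measure lebesgue K) \<le> cost K v \<theta>"
      using abs_cost_le[OF v _ B, of \<theta>] by (auto simp: admissible_def)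
  qed
qed

lemma admissible_midpoint:
  fixes f :: "'m::finite \<Rightarrow> real ^ 'd \<Rightarrow> real ^ 'n"
  assumes "\<And>i. integrable (lebesgue_on K) (f i)" "\<theta> \<in> admissible K f \<alpha>" "\<eta> \<in> admissible K f \<alpha>"
  shows "(\<lambda>x. (1/2) *\<^sub>R (\<theta> x + \<eta> x)) \<in> admissible K f \<alpha>"
  using assms mixed_integral_midpoint[OF K, of f \<theta> \<eta>] meas_simplex_midpoint[of \<theta> K \<eta>]
  unfolding admissible_def by (simp flip: scaleR_add_left)

lemma integrable_norm_power2:
  fixes u :: "real ^ 'd \<Rightarrow> real ^ 'm"
  assumes "u \<in> borel_measurable (lebesgue_on K)" "\<And>x. x \<in> K \<Longrightarrow> norm (u x) \<le> B"
  shows "integrable (lebesgue_on K) (\<lambda>x. (norm (u x))\<^sup>2)"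
proof (rule integrable_bounded_on_compact[OF K])
  show "(\<lambda>x. (norm (u x))\<^sup>2) \<in> borel_measurable (lebesgue_on K)" using assms(1) by measurable
  show "norm ((norm (u x))\<^sup>2) \<le> B\<^sup>2" if "x \<in> K" for x
    using assms(2)[OF that] by (simp add: power_mono)
qed

text \<open>Turns smallness in L2, which the parallelogram law delivers, into smallness in L1, from
  which an almost everywhere Cauchy subsequence can be extracted.\<close>

lemma integral_norm_le_power2:
  fixes u :: "real ^ 'd \<Rightarrow> real ^ 'm"
  assumes u: "u \<in> borel_measurable (lebesgue_on K)" "\<And>x. x \<in> K \<Longrightarrow> norm (u x) \<le> B" and "\<epsilon> > 0"
  shows "(\<integral>x. norm (u x) \<partial>lebesgue_on K)
    \<le> \<epsilon> * measure lebesgue K + (1/\<epsilon>) * (\<integral>x. (norm (u x))\<^sup>2 \<partial>lebesgue_on K)"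
proof -
  note int2 = integrable_norm_power2[OF u]
  have "(\<integral>x. norm (u x) \<partial>lebesgue_on K) \<le> (\<integral>x. \<epsilon> + (1/\<epsilon>) * (norm (u x))\<^sup>2 \<partial>lebesgue_on K)"
  proof (rule integral_mono)
    show "integrable (lebesgue_on K) (\<lambda>x. norm (u x))"
      using u by (intro integrable_norm integrable_bounded_on_compact[OF K])
    show "integrable (lebesgue_on K) (\<lambda>x. \<epsilon> + (1/\<epsilon>) * (norm (u x))\<^sup>2)"
      using int2 finite_measure.integrable_const[OF finite_measure_on_compact[OF K]]
      by (intro Bochner_Integration.integrable_add integrable_mult_right)
    \<comment> \<open>With a for the norm, the right-hand side is
      \<open>a^2 - a * \<epsilon> + \<epsilon>^2\<close>; dividing by \<epsilon> gives the pointwise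
      bound.\<close>
    have "0 \<le> (norm (u x) - \<epsilon>)\<^sup>2 + norm (u x) * \<epsilon>" for x
      using \<open>\<epsilon> > 0\<close> by simp
    then show "norm (u x) \<le> \<epsilon> + (1/\<epsilon>) * (norm (u x))\<^sup>2" for x
      using \<open>\<epsilon> > 0\<close> by (simp add: field_simps power2_eq_square)
  qed
  also have "\<dots> = \<epsilon> * measure lebesgue K + (1/\<epsilon>) * (\<integral>x. (norm (u x))\<^sup>2 \<partial>lebesgue_on K)"
    using int2 K finite_measure.integrable_const[OF finite_measure_on_compact[OF K]]
    by (subst Bochner_Integration.integral_add)
      (auto simp: measure_restrict_space lmeasurable_compact fmeasurableD simp del: times_divide_eq_left)
  finally show ?thesis .
qed

lemma parallelogram_integral:
  fixes \<theta> \<eta> :: "real ^ 'd \<Rightarrow> real ^ 'm"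
  assumes \<theta>: "\<theta> \<in> meas_simplex K" and \<eta>: "\<eta> \<in> meas_simplex K"
  shows "(\<integral>x. (norm (\<theta> x - \<eta> x))\<^sup>2 \<partial>lebesgue_on K)
    = 2 * (\<integral>x. (norm (\<theta> x))\<^sup>2 \<partial>lebesgue_on K) + 2 * (\<integral>x. (norm (\<eta> x))\<^sup>2 \<partial>lebesgue_on K)
      - 4 * (\<integral>x. (norm ((1/2) *\<^sub>R (\<theta> x + \<eta> x)))\<^sup>2 \<partial>lebesgue_on K)"
proof -
  have int: "integrable (lebesgue_on K) (\<lambda>x. (norm (\<xi> x))\<^sup>2)" if "\<xi> \<in> meas_simplex K" for \<xi> :: "real ^ 'd \<Rightarrow> real ^ 'm"
    using that by (intro integrable_norm_power2[of _ 1])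
      (auto intro: meas_simplex_measurable norm_std_simplex_le_1 meas_simplex_in_simplex)
  have "(norm (a - b))\<^sup>2 = 2 * (norm a)\<^sup>2 + 2 * (norm b)\<^sup>2 - 4 * (norm ((1/2) *\<^sub>R (a + b)))\<^sup>2"
    for a b :: "real ^ 'm"
    by (simp add: power2_norm_eq_inner inner_diff inner_add inner_commute algebra_simps)
  then have "(\<integral>x. (norm (\<theta> x - \<eta> x))\<^sup>2 \<partial>lebesgue_on K)
    = (\<integral>x. 2 * (norm (\<theta> x))\<^sup>2 + 2 * (norm (\<eta> x))\<^sup>2 - 4 * (norm ((1/2) *\<^sub>R (\<theta> x + \<eta> x)))\<^sup>2 \<partial>lebesgue_on K)"
    by simp
  also have "\<dots> = 2 * (\<integral>x. (norm (\<theta> x))\<^sup>2 \<partial>lebesgue_on K) + 2 * (\<integral>x. (norm (\<eta> x))\<^sup>2 \<partial>lebesgue_on K)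
      - 4 * (\<integral>x. (norm ((1/2) *\<^sub>R (\<theta> x + \<eta> x)))\<^sup>2 \<partial>lebesgue_on K)"
    using int[OF \<theta>] int[OF \<eta>] int[OF meas_simplex_midpoint[OF \<theta> \<eta>]]
    by (simp del: scaleR_add_right norm_scaleR)
  finally show ?thesis .
qed

lemma meas_simplex_AE_limit:
  fixes \<theta>s :: "nat \<Rightarrow> real ^ 'd \<Rightarrow> real ^ 'm"
  assumes \<theta>s: "\<And>n. \<theta>s n \<in> meas_simplex K" and Cauchy: "AE x in lebesgue_on K. Cauchy (\<lambda>n. \<theta>s n x)"
  obtains \<theta> where "\<theta> \<in> meas_simplex K" "AE x in lebesgue_on K. (\<lambda>n. \<theta>s n x) \<longlonglongrightarrow> \<theta> x"
proof
  define L where "L x = lim (\<lambda>n. \<theta>s n x)" for x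
  \<comment> \<open>\<open>meas_simplex\<close> constrains every point of \<open>K\<close>, while
    the limit is controlled only almost everywhere; elsewhere the first control supplies a value in
    the simplex.\<close>
  define \<theta> where "\<theta> x = (if L x \<in> std_simplex then L x else \<theta>s 0 x)" for x
  note [measurable] = meas_simplex_measurable[OF \<theta>s]
  have [measurable]: "L \<in> borel_measurable (lebesgue_on K)"
    unfolding L_def[abs_def] by (rule borel_measurable_lim_metric) measurable
  have [measurable]: "(std_simplex :: (real ^ 'm) set) \<in> sets borel"
    by (intro borel_closed closed_std_simplex)
  have "\<theta> \<in> borel_measurable (lebesgue_on K)"
    unfolding \<theta>_def[abs_def] by measurable
  then show "\<theta> \<in> meas_simplex K"
    using meas_simplex_in_simplex[OF \<theta>s] by (auto simp: meas_simplex_def \<theta>_def)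
  show "AE x in lebesgue_on K. (\<lambda>n. \<theta>s n x) \<longlonglongrightarrow> \<theta> x"
    using Cauchy AE_space
  proof eventually_elim
    case (elim x)
    then have "(\<lambda>n. \<theta>s n x) \<longlonglongrightarrow> L x"
      unfolding L_def using Cauchy_convergent convergent_LIMSEQ_iff by blast
    moreover from this have "L x \<in> std_simplex"
      by (rule closed_sequentially[OF closed_std_simplex, rotated])
        (use elim(2) meas_simplex_in_simplex[OF \<theta>s] in simp)
    ultimately show ?case
      by (simp add: \<theta>_def)
  qed
qed

text \<open>Weak compactness is avoided: a minimizing sequence whose members have almost minimal
  \<open>L\<^sup>2\<close> norm among the almost optimal controls is Cauchy in \<open>L\<^sup>2\<close>, by the parallelogram law.\<close>

lemma exists_solution:
  fixes f :: "'m::finite \<Rightarrow> real ^ 'd \<Rightarrow> real ^ 'n"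
  assumes f: "\<And>i. integrable (lebesgue_on K) (f i)"
    and ne: "admissible K f \<alpha> \<noteq> {}" and v: "continuous_on K v"
  shows "\<exists>\<theta>. is_solution K f \<alpha> v \<theta>"
proof -
  let ?M = "measure lebesgue K"
  define A where "A = admissible K f \<alpha>"
  have AD: "\<theta> \<in> meas_simplex K" "mixed_integral K f \<theta> = \<alpha>" if "\<theta> \<in> A" for \<theta>
    using that by (auto simp: A_def admissible_def)
  define Q where "Q \<theta> = (\<integral>x. (norm (\<theta> x))\<^sup>2 \<partial>lebesgue_on K)" for \<theta> :: "real ^ 'd \<Rightarrow> real ^ 'm"
  define c where "c = (INF \<theta>\<in>A. cost K v \<theta>)"
  have bddc: "bdd_below (cost K v ` A)"
    unfolding A_def by (rule bdd_below_cost[OF v])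
  have neA: "A \<noteq> {}" using ne by (simp add: A_def)
  have c: "c \<le> cost K v \<theta>" if "\<theta> \<in> A" for \<theta>
    unfolding c_def using that bddc by (intro cINF_lower)
  define e where "e n = 1 / real (Suc n)" for n
  have e0: "e \<longlonglongrightarrow> 0" unfolding e_def by (rule LIMSEQ_Suc[OF lim_1_over_n])
  have epos: "e n > 0" for n by (simp add: e_def)
  have emono: "e n \<le> e m" if "m \<le> n" for m n
    using that by (simp add: e_def frac_le)
  \<comment> \<open>Nested nonempty sets, stable under midpoints. They stand in for the set of exact
    minimizers, which is not yet known to be nonempty.\<close>
  define D where "D n = {\<theta> \<in> A. cost K v \<theta> \<le> c + e n}" for n
  have Dmono: "D n \<subseteq> D m" if "m \<le> n" for m n
    using emono[OF that] by (auto simp: D_def)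
  have Dne: "D n \<noteq> {}" for n
  proof -
    have "c < c + e n" using epos by simp
    then obtain \<theta> where "\<theta> \<in> A" "cost K v \<theta> < c + e n"
      unfolding c_def using neA bddc by (subst (asm) cINF_less_iff) auto
    then show ?thesis by (auto simp: D_def)
  qed
  have Q0: "0 \<le> Q \<theta>" for \<theta> by (simp add: Q_def)
  have bddQ: "bdd_below (Q ` X)" for X by (rule bdd_belowI2[of _ 0]) (rule Q0)
  have QM: "Q \<theta> \<le> ?M" if "\<theta> \<in> A" for \<theta>
  proof -
    have le1: "norm (\<theta> x) \<le> 1" if "x \<in> K" for x
      using norm_std_simplex_le_1[OF meas_simplex_in_simplex[OF AD(1)[OF \<open>\<theta> \<in> A\<close>] that]] .
    have "Q \<theta> \<le> (\<integral>x. 1 \<partial>lebesgue_on K)"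
      unfolding Q_def
    proof (rule integral_mono)
      show "integrable (lebesgue_on K) (\<lambda>x. (norm (\<theta> x))\<^sup>2)"
        using le1 meas_simplex_measurable[OF AD(1)[OF \<open>\<theta> \<in> A\<close>]] by (intro integrable_norm_power2[of _ 1])
    qed (use le1 finite_measure.integrable_const[OF finite_measure_on_compact[OF K]]
        in \<open>auto intro: power_le_one\<close>)
    then show ?thesis
      using K by (simp add: measure_restrict_space lmeasurable_compact fmeasurableD)
  qed
  \<comment> \<open>\<open>\<rho>\<close> increases because the sets \<open>D n\<close> shrink, and
    it is bounded because controls have norm at most 1. Its convergence drives the Cauchy
    estimate.\<close>
  define \<rho> where "\<rho> n = (INF \<theta>\<in>D n. Q \<theta>)" for n
  have \<rho>le: "\<rho> n \<le> Q \<theta>" if "\<theta> \<in> D n" for \<theta> n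
    unfolding \<rho>_def using that bddQ by (rule cINF_lower[rotated])
  have "incseq \<rho>"
    unfolding \<rho>_def by (intro monoI cINF_superset_mono) (use Dne Dmono bddQ in auto)
  have \<rho>M: "\<rho> n \<le> ?M" for n
  proof -
    obtain \<theta> where "\<theta> \<in> D n" using Dne by blast
    with \<rho>le[OF this] QM[of \<theta>] show ?thesis by (auto simp: D_def)
  qed
  obtain R where R: "\<rho> \<longlonglongrightarrow> R" "\<And>n. \<rho> n \<le> R"
    using incseq_convergent[OF \<open>incseq \<rho>\<close>, of ?M] \<rho>M by blast
  have "\<exists>\<theta>. \<theta> \<in> D n \<and> Q \<theta> \<le> \<rho> n + e n" for n
  proof -
    have "(INF \<theta>\<in>D n. Q \<theta>) < \<rho> n + e n" using epos by (simp add: \<rho>_def)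
    then obtain \<theta> where "\<theta> \<in> D n" "Q \<theta> < \<rho> n + e n"
      using Dne bddQ by (subst (asm) cINF_less_iff) auto
    then show ?thesis by (intro exI[of _ \<theta>]) auto
  qed
  then obtain s where s: "\<And>n. s n \<in> D n" "\<And>n. Q (s n) \<le> \<rho> n + e n" by metis
  have sA: "s n \<in> A" for n using s(1) by (auto simp: D_def)
  note sS = AD(1)[OF sA]
  \<comment> \<open>The midpoint of \<open>s j\<close> and \<open>s k\<close> lies in
    \<open>D N\<close>, so its squared norm is at least \<open>\<rho> N\<close>, while both
    endpoints are at most \<open>R + e N\<close>; the parallelogram law turns this gap into a bound
    on the distance.\<close>
  have L2: "(\<integral>x. (norm (s j x - s k x))\<^sup>2 \<partial>lebesgue_on K) \<le> 4 * (R - \<rho> N + e N)"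
    if "N \<le> j" "N \<le> k" for N j k
  proof -
    have "(\<lambda>x. (1/2) *\<^sub>R (s j x + s k x)) \<in> D N"
    proof -
      have "s j \<in> D N" "s k \<in> D N" using s(1) Dmono that by blast+
      then have "cost K v (s j) \<le> c + e N" "cost K v (s k) \<le> c + e N" by (auto simp: D_def)
      moreover have "(\<lambda>x. (1/2) *\<^sub>R (s j x + s k x)) \<in> A"
        unfolding A_def by (intro admissible_midpoint f sA[unfolded A_def])
      ultimately show ?thesis
        unfolding D_def using cost_midpoint[OF K v sS sS, of j k] by auto
    qed
    note mid = \<rho>le[OF this]
    have "Q (s j) \<le> R + e N" "Q (s k) \<le> R + e N"
      using s(2)[of j] s(2)[of k] R(2)[of j] R(2)[of k] emono[OF that(1)] emono[OF that(2)] by linarith+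
    moreover have "(\<integral>x. (norm (s j x - s k x))\<^sup>2 \<partial>lebesgue_on K)
        = 2 * Q (s j) + 2 * Q (s k) - 4 * Q (\<lambda>x. (1/2) *\<^sub>R (s j x + s k x))"
      unfolding Q_def by (rule parallelogram_integral[OF sS sS])
    moreover have "2 * a + 2 * b - 4 * q \<le> 4 * (R - p + d)"
      if "a \<le> R + d" "b \<le> R + d" "p \<le> q" for a b p q d :: real
      using that by (simp add: algebra_simps)
    ultimately show ?thesis
      using mid by presburger
  qed
  have lim0: "(\<lambda>N. 4 * (R - \<rho> N + e N)) \<longlonglongrightarrow> 0"
    using tendsto_mult[OF tendsto_const[of 4] tendsto_add[OF tendsto_diff[OF tendsto_const[of R] R(1)] e0]] by simp
  have le1: "norm (s n x) \<le> 1" if "x \<in> K" for n x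
    using norm_std_simplex_le_1[OF meas_simplex_in_simplex[OF sS that]] .
  have ints: "integrable (lebesgue_on K) (s n)" for n
    by (rule integrable_bounded_on_compact[OF K meas_simplex_measurable[OF sS] le1])
  have L1: "\<exists>N. \<forall>i\<ge>N. \<forall>j\<ge>N. (\<integral>x. norm (s i x - s j x) \<partial>lebesgue_on K) < \<delta>" if "\<delta> > 0" for \<delta>
  proof -
    \<comment> \<open>Splits \<delta> into halves: this \<epsilon> handles the term
      \<open>\<epsilon> * ?M\<close>, and \<open>N\<close> below is chosen so that the L2 term,
      after division by \<epsilon>, stays under the other half. Adding 1 covers a null
      \<open>K\<close>.\<close>
    define \<epsilon> where "\<epsilon> = \<delta> / (2 * (?M + 1))"
    have "\<epsilon> > 0" using that by (simp add: \<epsilon>_def add_nonneg_pos)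
    have \<epsilon>M: "\<epsilon> * ?M \<le> \<delta> / 2"
    proof -
      have "\<epsilon> * ?M \<le> \<epsilon> * (?M + 1)" using \<open>\<epsilon> > 0\<close> by simp
      also have "\<dots> = \<delta> / 2"
        using add_nonneg_pos[of ?M 1] unfolding \<epsilon>_def by (simp add: field_simps)
      finally show ?thesis .
    qed
    have "\<forall>\<^sub>F N in sequentially. 4 * (R - \<rho> N + e N) < \<epsilon> * (\<delta> / 2)"
      using lim0 \<open>\<epsilon> > 0\<close> that by (intro order_tendstoD) auto
    then obtain N where N: "4 * (R - \<rho> N + e N) < \<epsilon> * (\<delta> / 2)"
      by (auto simp: eventually_sequentially)
    have "(\<integral>x. norm (s i x - s j x) \<partial>lebesgue_on K) < \<delta>" if "i \<ge> N" "j \<ge> N" for i j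
    proof -
      have "(\<integral>x. norm (s i x - s j x) \<partial>lebesgue_on K)
         \<le> \<epsilon> * ?M + (1/\<epsilon>) * (\<integral>x. (norm (s i x - s j x))\<^sup>2 \<partial>lebesgue_on K)"
      proof (rule integral_norm_le_power2[where B = 2])
        show "norm (s i x - s j x) \<le> 2" if "x \<in> K" for x
          using le1[OF that, of i] le1[OF that, of j] norm_triangle_ineq4[of "s i x" "s j x"] by linarith
      qed (use ints \<open>\<epsilon> > 0\<close> in auto)
      also have "(1/\<epsilon>) * (\<integral>x. (norm (s i x - s j x))\<^sup>2 \<partial>lebesgue_on K) < (1/\<epsilon>) * (\<epsilon> * (\<delta> / 2))"
        using L2[OF that] N \<open>\<epsilon> > 0\<close> by (intro mult_strict_left_mono) auto
      finally show ?thesis using \<epsilon>M \<open>\<epsilon> > 0\<close> by simp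
    qed
    then show ?thesis by blast
  qed
  obtain r where r: "strict_mono r" "AE x in lebesgue_on K. Cauchy (\<lambda>n. s (r n) x)"
    using cauchy_L1_AE_cauchy_subseq[OF ints L1] by blast
  obtain \<theta> where \<theta>: "\<theta> \<in> meas_simplex K" "AE x in lebesgue_on K. (\<lambda>n. s (r n) x) \<longlonglongrightarrow> \<theta> x"
    using meas_simplex_AE_limit[OF sS r(2)] by blast
  have "(\<lambda>n. mixed_integral K f (s (r n))) \<longlonglongrightarrow> mixed_integral K f \<theta>"
    by (rule mixed_integral_tendsto_AE[OF K f sS \<theta>])
  then have \<theta>A: "\<theta> \<in> A"
    using \<theta>(1) AD(2)[OF sA] by (auto simp: A_def admissible_def LIMSEQ_const_iff)
  have "cost K v \<theta> \<le> c + 0"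
  proof (rule LIMSEQ_le)
    show "(\<lambda>n. cost K v (s (r n))) \<longlonglongrightarrow> cost K v \<theta>"
      by (rule cost_tendsto_AE[OF K v sS \<theta>])
    show "(\<lambda>n. c + e (r n)) \<longlonglongrightarrow> c + 0"
      using LIMSEQ_subseq_LIMSEQ[OF e0 r(1)] by (intro tendsto_intros) (simp add: o_def)
    show "\<exists>N. \<forall>n\<ge>N. cost K v (s (r n)) \<le> c + e (r n)"
      using s(1) by (auto simp: D_def)
  qed
  then show ?thesis
    using \<theta>A c unfolding is_solution_def A_def by force
qed

end

section \<open>Extremality of unique optimal controls\<close>

text \<open>With at most one positive component, \<zeta> is a vertex. A combination of nonnegative
  numbers with positive weights vanishes only if both do, so the ends of a segment through \<zeta>
  would both be that vertex.\<close>

lemma extreme_point_of_std_simplexI: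
  fixes \<zeta> :: "real ^ 'm"
  assumes \<zeta>: "\<zeta> \<in> std_simplex" and one: "\<And>i j. i \<noteq> j \<Longrightarrow> \<zeta> $ i \<le> 0 \<or> \<zeta> $ j \<le> 0"
  shows "\<zeta> extreme_point_of std_simplex"
proof -
  have "\<exists>i. \<zeta> $ i \<noteq> 0"
  proof (rule ccontr)
    assume "\<nexists>i. \<zeta> $ i \<noteq> 0"
    then have "(\<Sum>i\<in>UNIV. \<zeta> $ i) = 0" by simp
    then show False using \<zeta> by (simp add: std_simplex_def)
  qed
  then obtain i where i: "\<zeta> $ i \<noteq> 0" ..
  have zero: "\<zeta> $ j = 0" if "j \<noteq> i" for j
    using one[OF that] i std_simplex_component(1)[OF \<zeta>, of i] std_simplex_component(1)[OF \<zeta>, of j] by linarith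
  have vertex: "a = axis i 1" if "a \<in> std_simplex" "\<And>j. j \<noteq> i \<Longrightarrow> a $ j = 0" for a :: "real ^ 'm"
  proof -
    have "(\<Sum>j\<in>UNIV. a $ j) = a $ i"
      using that(2) by (subst sum.remove[of UNIV i]) auto
    then have "a $ i = 1" using that(1) by (simp add: std_simplex_def)
    then show ?thesis using that(2) by (simp add: vec_eq_iff axis_def)
  qed
  show ?thesis
    unfolding extreme_point_of_def
  proof (intro conjI ballI notI \<zeta>)
    fix a b :: "real ^ 'm"
    assume a: "a \<in> std_simplex" and b: "b \<in> std_simplex" and "\<zeta> \<in> open_segment a b"
    then obtain u where u: "a \<noteq> b" "0 < u" "u < 1" "\<zeta> = (1 - u) *\<^sub>R a + u *\<^sub>R b"
      by (auto simp: in_segment)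
    have "a $ j = 0 \<and> b $ j = 0" if "j \<noteq> i" for j
    proof -
      have "(1 - u) * a $ j + u * b $ j = 0"
        using zero[OF that] u(4) by simp
      moreover have "0 \<le> (1 - u) * a $ j" "0 \<le> u * b $ j"
        using u std_simplex_component(1)[OF a] std_simplex_component(1)[OF b] by auto
      ultimately have "(1 - u) * a $ j = 0" "u * b $ j = 0" by linarith+
      then show ?thesis using u by simp
    qed
    then have "a = axis i 1" "b = axis i 1"
      using vertex[OF a] vertex[OF b] by blast+
    then show False using u(1) by simp
  qed
qed

text \<open>Among the first \<open>DIM('a) + 1\<close> vectors there is a linear relation. Linear
  dependence is a notion for sets, so a repeated vector in the family is treated apart, with
  coefficients 1 and -1.\<close>

lemma nontrivial_vanishing_combination:
  fixes u :: "nat \<Rightarrow> 'a::euclidean_space"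
  obtains c :: "nat \<Rightarrow> real" and N l
  where "l \<le> N" "c l \<noteq> 0" "(\<Sum>l\<le>N. c l *\<^sub>R u l) = 0"
proof (cases "inj u")
  case True
  let ?N = "DIM('a)"
  have card: "card (u ` {..?N}) > DIM('a)"
    using card_image[OF inj_on_subset[OF True, of "{..?N}"]] by simp
  have "dependent (u ` {..?N})"
    by (rule dependent_biggerset) (rule card)
  then obtain c where c: "\<exists>v\<in>u ` {..?N}. c v \<noteq> 0" "(\<Sum>v\<in>u ` {..?N}. c v *\<^sub>R v) = 0"
    using real_vector.dependent_finite[of "u ` {..?N}"] by auto
  from c(2) have "(\<Sum>l\<le>?N. c (u l) *\<^sub>R u l) = 0"
    using True by (subst (asm) sum.reindex) (auto intro: inj_on_subset simp: o_def)
  then show thesis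
    using c(1) that[of _ ?N "\<lambda>l. c (u l)"] by auto
next
  case False
  then obtain a b where ab: "a \<noteq> b" "u a = u b" by (auto simp: inj_def)
  define c :: "nat \<Rightarrow> real" where "c l = (if l = a then 1 else 0) - (if l = b then 1 else 0)" for l
  have "(\<Sum>l\<le>a + b. c l *\<^sub>R u l) =
    (\<Sum>l\<le>a + b. (if l = a then u l else 0)) - (\<Sum>l\<le>a + b. (if l = b then u l else 0))"
    unfolding sum_subtractf[symmetric] by (rule sum.cong) (auto simp: c_def)
  also have "\<dots> = 0" using ab by simp
  finally show thesis
    using ab by (intro that[of a "a + b" c]) (auto simp: c_def)
qed

text \<open>A nonzero polynomial has finitely many roots, so its zeros as a function of one
  coordinate form finitely many parallel hyperplanes, all negligible.\<close>

lemma AE_coordinate_polynomial_nonzero: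
  fixes S :: "(real ^ 'd) set" and c :: "nat \<Rightarrow> real"
  assumes S: "S \<in> sets lebesgue" and c: "l \<le> N" "c l \<noteq> 0"
  shows "AE x in lebesgue_on S. (\<Sum>l\<le>N. c l * (x $ k) ^ l) \<noteq> 0"
proof -
  define Z where "Z = {t. (\<Sum>l\<le>N. c l * t ^ l) = 0}"
  have "finite Z"
    unfolding Z_def by (subst Poly_Roots.polyfun_finite_roots) (use c in blast)
  have "negligible (\<Union>t\<in>Z. {x :: real ^ 'd. x $ k = t})"
  proof (rule negligible_Union)
    show "finite ((\<lambda>t. {x :: real ^ 'd. x $ k = t}) ` Z)" using \<open>finite Z\<close> by simp
    show "negligible T" if "T \<in> (\<lambda>t. {x :: real ^ 'd. x $ k = t}) ` Z" for T
      using that by (auto simp: cart_eq_inner_axis intro!: negligible_standard_hyperplane)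
  qed
  then have "AE x in lebesgue. x \<notin> (\<Union>t\<in>Z. {x :: real ^ 'd. x $ k = t})"
    by (intro AE_not_in) (simp add: negligible_iff_null_sets)
  then have "AE x in lebesgue_on S. x \<notin> (\<Union>t\<in>Z. {x :: real ^ 'd. x $ k = t})"
    using S by (subst AE_restrict_space_iff) auto
  then show ?thesis
    by eventually_elim (auto simp: Z_def)
qed

context
  fixes K :: "(real ^ 'd) set"
  assumes K: "compact K"
begin

text \<open>Lyapunov's argument: finitely many linear constraints cannot exclude all perturbations
  supported on \<open>E\<close>. Polynomials in one coordinate form an infinite-dimensional space of
  perturbations none of which vanishes on a set of positive measure.\<close>

lemma exists_perturbation:
  fixes p :: "real ^ 'd \<Rightarrow> real ^ 'n"
  assumes E: "E \<in> sets lebesgue" and p: "integrable (lebesgue_on K) p" and "\<epsilon> > 0"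
  obtains h :: "real ^ 'd \<Rightarrow> real" where
    "h \<in> borel_measurable (lebesgue_on K)"
    "\<And>x. x \<in> K \<Longrightarrow> \<bar>h x\<bar> \<le> \<epsilon>" "\<And>x. x \<notin> E \<Longrightarrow> h x = 0"
    "(\<integral>x. h x *\<^sub>R p x \<partial>lebesgue_on K) = 0"
    "AE x in lebesgue_on K. x \<in> E \<longrightarrow> h x \<noteq> 0"
proof -
  \<comment> \<open>Any coordinate will do; index types are nonempty.\<close>
  fix k :: 'd
  have KS: "K \<in> sets lebesgue" using K by (simp add: fmeasurableD lmeasurable_compact)
  define m where "m l x = indicator E x * (x $ k) ^ l" for l and x :: "real ^ 'd"
  have indE: "indicator E \<in> borel_measurable (lebesgue_on K)"
    using E by (intro measurable_restrict_space1) auto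
  have bounded: "\<exists>B. \<forall>x\<in>K. \<bar>g x\<bar> \<le> B" if "continuous_on K g" for g :: "real ^ 'd \<Rightarrow> real"
    using compact_imp_bounded[OF compact_continuous_image[OF that K]] by (auto simp: bounded_iff)
  have int: "integrable (lebesgue_on K) (\<lambda>x. m l x *\<^sub>R p x)" for l
  proof -
    have cont: "continuous_on K (\<lambda>x. (x $ k) ^ l)" by (intro continuous_intros)
    then obtain B where B: "\<forall>x\<in>K. \<bar>(x $ k) ^ l\<bar> \<le> B" using bounded by blast
    show ?thesis
    proof (rule integrable_bounded_scaleR[OF K p])
      show "m l \<in> borel_measurable (lebesgue_on K)"
        unfolding m_def[abs_def]
        by (intro borel_measurable_times indE borel_measurable_continuous_lebesgue_on[OF K cont])
      show "\<bar>m l x\<bar> \<le> B" if "x \<in> K" for x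
        using B that by (auto simp: m_def indicator_def intro: order_trans[OF abs_ge_zero])
    qed
  qed
  \<comment> \<open>The constraint sends the infinitely many monomials cut off to \<open>E\<close>
    into a finite-dimensional space, so some nontrivial combination of them is annihilated.\<close>
  obtain c N l where c: "l \<le> N" "c l \<noteq> 0" "(\<Sum>l\<le>N. c l *\<^sub>R (\<integral>x. m l x *\<^sub>R p x \<partial>lebesgue_on K)) = 0"
    by (rule nontrivial_vanishing_combination)
  define q where "q x = (\<Sum>l\<le>N. c l * (x $ k) ^ l)" for x :: "real ^ 'd"
  have cq: "continuous_on K q" unfolding q_def by (intro continuous_intros)
  then obtain B where B: "\<And>x. x \<in> K \<Longrightarrow> \<bar>q x\<bar> \<le> B" using bounded by blast
  \<comment> \<open>Scales the bound on \<open>q\<close> down to \<epsilon>;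
    \<open>\<bar>B\<bar> + 1\<close> is positive even if \<open>B\<close> is not, which can happen
    for empty \<open>K\<close>.\<close>
  define s where "s = \<epsilon> / (\<bar>B\<bar> + 1)"
  have "s > 0" using \<open>\<epsilon> > 0\<close> by (simp add: s_def add_nonneg_pos)
  define h where "h x = indicator E x * (s * q x)" for x
  show thesis
  proof
    show "h \<in> borel_measurable (lebesgue_on K)"
      unfolding h_def[abs_def]
      by (intro borel_measurable_times borel_measurable_const indE borel_measurable_continuous_lebesgue_on[OF K cq])
    show "\<bar>h x\<bar> \<le> \<epsilon>" if "x \<in> K" for x
    proof -
      have "\<bar>h x\<bar> \<le> s * \<bar>q x\<bar>" using \<open>s > 0\<close> by (auto simp: h_def indicator_def abs_mult)
      also have "\<dots> \<le> s * (\<bar>B\<bar> + 1)" using B[OF that] \<open>s > 0\<close> by (intro mult_left_mono) auto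
      also have "\<dots> = \<epsilon>" using add_nonneg_pos[of "\<bar>B\<bar>" 1] by (simp add: s_def)
      finally show ?thesis .
    qed
    show "h x = 0" if "x \<notin> E" for x using that by (simp add: h_def)
    have "h x *\<^sub>R p x = s *\<^sub>R (\<Sum>l\<le>N. c l *\<^sub>R (m l x *\<^sub>R p x))" for x
      by (simp add: h_def q_def m_def scaleR_sum_left[symmetric] sum_distrib_left mult_ac)
    then have "(\<integral>x. h x *\<^sub>R p x \<partial>lebesgue_on K)
      = s *\<^sub>R (\<Sum>l\<le>N. c l *\<^sub>R (\<integral>x. m l x *\<^sub>R p x \<partial>lebesgue_on K))"
      using int by (simp add: Bochner_Integration.integral_sum del: scaleR_scaleR)
    then show "(\<integral>x. h x *\<^sub>R p x \<partial>lebesgue_on K) = 0" using c(3) by simp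
    show "AE x in lebesgue_on K. x \<in> E \<longrightarrow> h x \<noteq> 0"
      using AE_coordinate_polynomial_nonzero[where c = c and k = k, OF KS c(1,2)] \<open>s > 0\<close>
      by (auto simp: h_def q_def)
  qed
qed

text \<open>Moving mass \<open>h\<close> from component \<open>j\<close> to component
  \<open>i\<close> affects only these two terms, so all that \<open>h\<close> has to annihilate is
  the single vector field \<open>f i - f j\<close>.\<close>

lemma mixed_integral_perturb:
  fixes f :: "'m::finite \<Rightarrow> real ^ 'd \<Rightarrow> real ^ 'n"
  assumes f: "\<And>i. integrable (lebesgue_on K) (f i)" and \<theta>: "\<theta> \<in> meas_simplex K"
    and h: "h \<in> borel_measurable (lebesgue_on K)" "\<And>x. x \<in> K \<Longrightarrow> \<bar>h x\<bar> \<le> B"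
  shows "mixed_integral K f (\<lambda>x. \<theta> x + h x *\<^sub>R (axis i 1 - axis j 1))
    = mixed_integral K f \<theta> + (\<integral>x. h x *\<^sub>R (f i x - f j x) \<partial>lebesgue_on K)"
proof -
  let ?I = "\<lambda>l. \<integral>x. h x *\<^sub>R f l x \<partial>lebesgue_on K"
  have int: "integrable (lebesgue_on K) (\<lambda>x. h x *\<^sub>R f l x)" for l
    by (rule integrable_bounded_scaleR[OF K f h])
  define \<delta> :: "'m \<Rightarrow> real" where "\<delta> l = (axis i 1 - axis j 1 :: real ^ 'm) $ l" for l
  have "(\<integral>x. ((\<theta> x + h x *\<^sub>R (axis i 1 - axis j 1)) $ l) *\<^sub>R f l x \<partial>lebesgue_on K)
    = (\<integral>x. (\<theta> x $ l) *\<^sub>R f l x \<partial>lebesgue_on K) + \<delta> l *\<^sub>R ?I l" for l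
  proof -
    have "((\<theta> x + h x *\<^sub>R (axis i 1 - axis j 1)) $ l) *\<^sub>R f l x
      = (\<theta> x $ l) *\<^sub>R f l x + \<delta> l *\<^sub>R (h x *\<^sub>R f l x)" for x
      by (simp add: \<delta>_def scaleR_add_left mult.commute)
    then show ?thesis
      using int integrable_meas_simplex_scaleR[OF K f \<theta>] by (simp del: scaleR_scaleR)
  qed
  moreover have "(\<Sum>l\<in>UNIV. \<delta> l *\<^sub>R ?I l) = ?I i - ?I j"
  proof -
    have "(\<Sum>l\<in>UNIV. \<delta> l *\<^sub>R ?I l)
      = (\<Sum>l\<in>UNIV. (if l = i then ?I l else 0) - (if l = j then ?I l else 0))"
      by (rule sum.cong) (auto simp: \<delta>_def axis_def)
    then show ?thesis by (simp add: sum_subtractf)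
  qed
  moreover have "?I i - ?I j = (\<integral>x. h x *\<^sub>R (f i x - f j x) \<partial>lebesgue_on K)"
    using int by (simp add: scaleR_diff_right)
  ultimately show ?thesis
    by (simp add: mixed_integral_def sum.distrib)
qed

lemma cost_perturb:
  fixes v :: "real ^ 'd \<Rightarrow> real ^ 'm"
  assumes v: "continuous_on K v" and \<theta>: "\<theta> \<in> meas_simplex K"
    and h: "h \<in> borel_measurable (lebesgue_on K)" "\<And>x. x \<in> K \<Longrightarrow> \<bar>h x\<bar> \<le> B"
  shows "cost K v (\<lambda>x. \<theta> x + h x *\<^sub>R (axis i 1 - axis j 1))
    = cost K v \<theta> + (\<integral>x. h x * ((axis i 1 - axis j 1) \<bullet> v x) \<partial>lebesgue_on K)"
proof -
  have "integrable (lebesgue_on K) (\<lambda>x. (h x *\<^sub>R (axis i 1 - axis j 1 :: real ^ 'm)) \<bullet> v x)"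
  proof (rule integrable_bounded_inner[OF K _ _ v])
    show "(\<lambda>x. h x *\<^sub>R (axis i 1 - axis j 1 :: real ^ 'm)) \<in> borel_measurable (lebesgue_on K)"
      using h(1) by measurable
    show "norm (h x *\<^sub>R (axis i 1 - axis j 1 :: real ^ 'm)) \<le> B * norm (axis i 1 - axis j 1 :: real ^ 'm)"
      if "x \<in> K" for x
      using h(2)[OF that] by (simp add: mult_right_mono)
  qed
  then show ?thesis
    using integrable_cost[OF K \<theta> v] by (simp add: cost_def inner_add_left)
qed

lemma std_simplex_perturb:
  fixes \<zeta> :: "real ^ 'm"
  assumes \<zeta>: "\<zeta> \<in> std_simplex" and "i \<noteq> j" "\<bar>t\<bar> \<le> \<zeta> $ i" "\<bar>t\<bar> \<le> \<zeta> $ j"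
  shows "\<zeta> + t *\<^sub>R (axis i 1 - axis j 1) \<in> std_simplex"
proof -
  have "(\<Sum>l\<in>UNIV. (\<zeta> + t *\<^sub>R (axis i 1 - axis j 1)) $ l)
    = (\<Sum>l\<in>UNIV. \<zeta> $ l) + ((\<Sum>l\<in>UNIV. if l = i then t else 0) - (\<Sum>l\<in>UNIV. if l = j then t else 0))"
    unfolding sum.distrib[symmetric] sum_subtractf[symmetric]
    by (rule sum.cong) (auto simp: axis_def)
  also have "\<dots> = 1" using \<zeta> by (simp add: std_simplex_def)
  finally show ?thesis
    using assms by (auto simp: std_simplex_def axis_def)
qed

lemma unique_solution_extreme:
  fixes f :: "'m::finite \<Rightarrow> real ^ 'd \<Rightarrow> real ^ 'n"
  assumes f: "\<And>i. integrable (lebesgue_on K) (f i)" and v: "continuous_on K v"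
    and sol: "is_solution K f \<alpha> v \<theta>"
    and unique: "\<And>\<eta>. is_solution K f \<alpha> v \<eta> \<Longrightarrow> AE x in lebesgue_on K. \<eta> x = \<theta> x"
  shows "AE x in lebesgue_on K. \<theta> x extreme_point_of std_simplex"
proof -
  have KS: "K \<in> sets lebesgue" using K by (simp add: fmeasurableD lmeasurable_compact)
  have \<theta>: "\<theta> \<in> meas_simplex K" "mixed_integral K f \<theta> = \<alpha>"
    and opt: "\<And>\<eta>. \<eta> \<in> admissible K f \<alpha> \<Longrightarrow> cost K v \<theta> \<le> cost K v \<eta>"
    using sol by (auto simp: is_solution_def admissible_def)
  note [measurable] = meas_simplex_measurable[OF \<theta>(1)]
  \<comment> \<open>A fixed threshold leaves room for every perturbation bounded by \<epsilon>. The
    thresholds \<open>1 / real (Suc n)\<close> then exhaust the set where two components are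
    positive.\<close>
  have null: "AE x in lebesgue_on K. \<not> (\<epsilon> \<le> \<theta> x $ i \<and> \<epsilon> \<le> \<theta> x $ j)"
    if "i \<noteq> j" "\<epsilon> > 0" for i j \<epsilon>
  proof -
    define E where "E = {x \<in> space (lebesgue_on K). \<epsilon> \<le> \<theta> x $ i \<and> \<epsilon> \<le> \<theta> x $ j}"
    have "E \<in> sets (lebesgue_on K)" unfolding E_def by measurable
    then have E: "E \<in> sets lebesgue" using KS by (simp add: sets_restrict_space_iff)
    have p: "integrable (lebesgue_on K) (\<lambda>x. f i x - f j x)" using f by auto
    obtain h where h: "h \<in> borel_measurable (lebesgue_on K)"
      "\<And>x. x \<in> K \<Longrightarrow> \<bar>h x\<bar> \<le> \<epsilon>" "\<And>x. x \<notin> E \<Longrightarrow> h x = 0"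
      "(\<integral>x. h x *\<^sub>R (f i x - f j x) \<partial>lebesgue_on K) = 0"
      "AE x in lebesgue_on K. x \<in> E \<longrightarrow> h x \<noteq> 0"
      using exists_perturbation[OF E p \<open>\<epsilon> > 0\<close>] by blast
    define P where "P s x = \<theta> x + (s * h x) *\<^sub>R (axis i 1 - axis j 1)" for s x
    have sh: "(\<lambda>x. s * h x) \<in> borel_measurable (lebesgue_on K)" "x \<in> K \<Longrightarrow> \<bar>s * h x\<bar> \<le> \<epsilon>"
      if "\<bar>s\<bar> = 1" for s x
      using h(1,2) that by (auto simp: abs_mult)
    have adm: "P s \<in> admissible K f \<alpha>" if s: "\<bar>s\<bar> = 1" for s
    proof -
      have "P s x \<in> std_simplex" if "x \<in> K" for x
        unfolding P_def
      proof (rule std_simplex_perturb)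
        show "\<theta> x \<in> std_simplex" using meas_simplex_in_simplex[OF \<theta>(1) that] .
        then show "\<bar>s * h x\<bar> \<le> \<theta> x $ i" "\<bar>s * h x\<bar> \<le> \<theta> x $ j"
          using sh(2)[OF s that] h(3)[of x] std_simplex_component(1)[of "\<theta> x"]
          by (cases "x \<in> E"; force simp: E_def)+
      qed fact
      moreover have "P s \<in> borel_measurable (lebesgue_on K)"
        unfolding P_def[abs_def] using h(1) by measurable
      moreover have "mixed_integral K f (P s) = \<alpha>"
        unfolding P_def[abs_def] using \<theta>(2) h(4)
        by (subst mixed_integral_perturb[OF f \<theta>(1) sh[OF s]]) (simp_all flip: scaleR_scaleR)
      ultimately show ?thesis by (simp add: admissible_def meas_simplex_def)
    qed
    have cost: "cost K v (P s) = cost K v \<theta> + s * (\<integral>x. h x * ((axis i 1 - axis j 1) \<bullet> v x) \<partial>lebesgue_on K)"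
      if s: "\<bar>s\<bar> = 1" for s
      unfolding P_def[abs_def] by (subst cost_perturb[OF v \<theta>(1) sh[OF s]]) (simp_all add: mult.assoc)
    \<comment> \<open>The change of cost is odd in \<open>s\<close> and, by optimality, nonnegative
      for both signs, hence zero.\<close>
    have "cost K v (P 1) = cost K v \<theta>"
      using opt[OF adm[of 1]] opt[OF adm[of "-1"]] cost[of 1] cost[of "-1"] by simp
    then have "is_solution K f \<alpha> v (P 1)"
      using opt adm[of 1] by (simp add: is_solution_def)
    \<comment> \<open>Uniqueness makes \<open>h\<close> vanish almost everywhere, since
      \<open>axis i 1 - axis j 1\<close> is nonzero; but \<open>h\<close> is nonzero almost
      everywhere on \<open>E\<close>, so \<open>E\<close> is null.\<close>
    from unique[OF this] h(5) show ?thesis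
      using AE_space
    proof eventually_elim
      case (elim x)
      have "(axis i 1 - axis j 1 :: real ^ 'm) $ i = 1" using \<open>i \<noteq> j\<close> by (simp add: axis_def)
      then have "(axis i 1 - axis j 1 :: real ^ 'm) \<noteq> 0" by (metis zero_index zero_neq_one)
      with elim have "x \<notin> E" by (auto simp: P_def)
      then show ?case using elim by (auto simp: E_def)
    qed
  qed
  have "AE x in lebesgue_on K. \<forall>n. i \<noteq> j \<longrightarrow>
      \<not> (1 / real (Suc n) \<le> \<theta> x $ i \<and> 1 / real (Suc n) \<le> \<theta> x $ j)" for i j
    unfolding AE_all_countable using null[of i j] by (cases "i = j") auto
  then have "AE x in lebesgue_on K. \<forall>i j n. i \<noteq> j \<longrightarrow>
      \<not> (1 / real (Suc n) \<le> \<theta> x $ i \<and> 1 / real (Suc n) \<le> \<theta> x $ j)"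
    by (intro eventually_all_finite)
  then show ?thesis
    using AE_space
  proof eventually_elim
    case (elim x)
    show ?case
    proof (rule extreme_point_of_std_simplexI)
      show "\<theta> x \<in> std_simplex" using elim(2) meas_simplex_in_simplex[OF \<theta>(1)] by simp
      show "\<theta> x $ i \<le> 0 \<or> \<theta> x $ j \<le> 0" if "i \<noteq> j" for i j
      proof (rule ccontr)
        assume "\<not> (\<theta> x $ i \<le> 0 \<or> \<theta> x $ j \<le> 0)"
        then have "0 < min (\<theta> x $ i) (\<theta> x $ j)" by simp
        then obtain n where "1 / real (Suc n) < min (\<theta> x $ i) (\<theta> x $ j)"
          using nat_approx_posE by blast
        then have "1 / real (Suc n) \<le> \<theta> x $ i" "1 / real (Suc n) \<le> \<theta> x $ j" by linarith+
        then show False using elim(1) that by blast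
      qed
    qed
  qed
qed

end

section \<open>Genericity of uniqueness\<close>

text \<open>Otherwise the increments of \<open>g\<close> over consecutive steps of length
  \<open>t\<close> would drop by at least \<open>\<epsilon> * t\<close> each time, and after enough
  steps leave the range from \<open>- C * t\<close> to \<open>C * t\<close> that the Lipschitz bound
  allows.\<close>

lemma lipschitz_symmetric_difference:
  fixes g :: "real \<Rightarrow> real"
  assumes lip: "\<And>a b. \<bar>g a - g b\<bar> \<le> C * \<bar>a - b\<bar>" and "\<delta> > 0" "\<epsilon> > 0"
  shows "\<exists>s t. 0 \<le> s \<and> s \<le> \<delta> \<and> t > 0 \<and> g (s + t) + g (s - t) - 2 * g s > - \<epsilon> * t"
proof (rule ccontr)
  assume neg: "\<not> ?thesis"
  have concave: "g (s + t) + g (s - t) - 2 * g s \<le> - \<epsilon> * t" if "0 \<le> s" "s \<le> \<delta>" "t > 0" for s t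
    using that neg by (meson not_le)
  \<comment> \<open>\<open>Suc N\<close> drops of size \<open>\<epsilon> * t\<close> exceed the
    length \<open>2 * C * t\<close> of that range, and the step \<open>t\<close> is chosen so that
    all centres lie in the interval from 0 to \<delta>.\<close>
  obtain N where N: "2 * C / \<epsilon> < real N" using reals_Archimedean2 by blast
  define t where "t = \<delta> / real (Suc N)"
  have "t > 0" using \<open>\<delta> > 0\<close> by (simp add: t_def)
  define d where "d j = g (real (Suc j) * t) - g (real j * t)" for j
  have "d j \<le> d 0 - real j * (\<epsilon> * t)" if "j \<le> Suc N" for j
    using that
  proof (induction j)
    case (Suc j)
    have "real (Suc j) * t \<le> \<delta>"
    proof -
      have "real (Suc j) * t \<le> real (Suc N) * t"
        using Suc.prems \<open>t > 0\<close> by (intro mult_right_mono) auto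
      then show ?thesis by (simp add: t_def)
    qed
    then have "g (real (Suc j) * t + t) + g (real (Suc j) * t - t) - 2 * g (real (Suc j) * t) \<le> - \<epsilon> * t"
      using \<open>t > 0\<close> by (intro concave) auto
    then have "d (Suc j) \<le> d j - \<epsilon> * t"
      by (simp add: d_def algebra_simps)
    with Suc show ?case by (simp add: algebra_simps)
  qed simp
  from this[of "Suc N"] have "d (Suc N) \<le> d 0 - \<epsilon> * (real (Suc N) * t)" by (simp add: algebra_simps)
  moreover have "\<bar>d j\<bar> \<le> C * t" for j
    using lip[of "real (Suc j) * t" "real j * t"] \<open>t > 0\<close> by (simp add: d_def algebra_simps)
  from this[of 0] this[of "Suc N"] have "d 0 \<le> C * t" "- (C * t) \<le> d (Suc N)" by linarith+
  ultimately have "\<epsilon> * (real (Suc N) * t) \<le> 2 * C * t" by linarith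
  then have "\<epsilon> * real (Suc N) \<le> 2 * C" using \<open>t > 0\<close> by (simp flip: mult.assoc)
  moreover have "2 * C < \<epsilon> * real N" using N \<open>\<epsilon> > 0\<close> by (simp add: pos_divide_less_eq mult.commute)
  ultimately show False using \<open>\<epsilon> > 0\<close> by (simp add: algebra_simps)
qed

section \<open>The optimal value as a function of the cost\<close>

definition optimal_value where
  "optimal_value K f \<alpha> v = (INF \<theta>\<in>admissible K f \<alpha>. cost K v \<theta>)"

text \<open>Elements of \<open>cont_space K\<close> are extensional, but a shifted cost
  \<open>v + t w\<close> need not be; this allows passing between it and its restriction.\<close>

lemma optimal_value_cong:
  assumes "\<And>x. x \<in> K \<Longrightarrow> v x = w x" shows "optimal_value K f \<alpha> v = optimal_value K f \<alpha> w"
proof -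
  have "cost K v \<theta> = cost K w \<theta>" for \<theta>
    unfolding cost_def by (rule Bochner_Integration.integral_cong) (use assms in auto)
  then show ?thesis by (simp add: optimal_value_def)
qed

lemma optimal_value_eq_cost:
  assumes "is_solution K f \<alpha> v \<theta>" shows "optimal_value K f \<alpha> v = cost K v \<theta>"
  unfolding optimal_value_def using assms
  by (intro cInf_eq_minimum) (auto simp: is_solution_def)

context
  fixes K :: "(real ^ 'd) set"
  assumes K: "compact K"
begin

text \<open>Compactness of \<open>K\<close> makes the boundedness built into
  \<open>cfunspace\<close> automatic.\<close>

lemma mspace_cont_space: "v \<in> mspace (cont_space K) \<longleftrightarrow> continuous_on K v \<and> v \<in> extensional K"
proof -
  have "compactin (top_of_set K) (topspace (top_of_set K))"
    using K by (simp add: compactin_subtopology)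
  from compactin_mspace_cfunspace[OF this, of euclidean_metric] show ?thesis
    by (auto simp: cont_space_def)
qed

lemma norm_le_mdist_cont_space:
  assumes "v \<in> mspace (cont_space K)" "w \<in> mspace (cont_space K)" "x \<in> K"
  shows "norm (v x - w x) \<le> mdist (cont_space K) v w"
  using mdist_cfunspace_imp_mdist_le[of v "top_of_set K" euclidean_metric w "mdist (cont_space K) v w" x] assms
  unfolding cont_space_def by (simp add: dist_norm)

lemma mdist_cont_space_le:
  assumes "0 \<le> B" "\<And>x. x \<in> K \<Longrightarrow> norm (v x - w x) \<le> B"
  shows "mdist (cont_space K) v w \<le> B"
  unfolding cont_space_def using assms by (intro mdist_cfunspace_le) (auto simp: dist_norm)

lemma optimal_value_le:
  fixes f :: "'m::finite \<Rightarrow> real ^ 'd \<Rightarrow> real ^ 'n"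
  assumes "continuous_on K v" "\<theta> \<in> admissible K f \<alpha>"
  shows "optimal_value K f \<alpha> v \<le> cost K v \<theta>"
  unfolding optimal_value_def using assms bdd_below_cost[OF K] by (intro cINF_lower)

text \<open>The cost of each admissible control is Lipschitz in \<open>v\<close> with the same
  constant, and an infimum of such functions inherits it.\<close>

lemma optimal_value_lipschitz:
  fixes f :: "'m::finite \<Rightarrow> real ^ 'd \<Rightarrow> real ^ 'n"
  assumes ne: "admissible K f \<alpha> \<noteq> {}" and v: "continuous_on K v" and w: "continuous_on K w"
    and B: "\<And>x. x \<in> K \<Longrightarrow> norm (v x - w x) \<le> B"
  shows "\<bar>optimal_value K f \<alpha> v - optimal_value K f \<alpha> w\<bar> \<le> B * measure lebesgue K"
proof -
  have "optimal_value K f \<alpha> p \<le> optimal_value K f \<alpha> q + B * measure lebesgue K"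
    if "continuous_on K p" "continuous_on K q" "\<And>x. x \<in> K \<Longrightarrow> norm (p x - q x) \<le> B" for p q
  proof -
    have "optimal_value K f \<alpha> p - B * measure lebesgue K \<le> cost K q \<theta>" if "\<theta> \<in> admissible K f \<alpha>" for \<theta>
    proof -
      have "\<bar>cost K p \<theta> - cost K q \<theta>\<bar> \<le> B * measure lebesgue K"
        using that \<open>continuous_on K p\<close> \<open>continuous_on K q\<close> \<open>\<And>x. x \<in> K \<Longrightarrow> norm (p x - q x) \<le> B\<close>
        by (intro cost_diff_le[OF K]) (auto simp: admissible_def)
      then show ?thesis
        using optimal_value_le[OF \<open>continuous_on K p\<close> that] by linarith
    qed
    then have "optimal_value K f \<alpha> p - B * measure lebesgue K \<le> optimal_value K f \<alpha> q"
      unfolding optimal_value_def[of K f \<alpha> q] using ne by (intro cINF_greatest)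
    then show ?thesis by linarith
  qed
  from this[OF v w B] this[OF w v] B show ?thesis
    by (auto simp: abs_le_iff norm_minus_commute)
qed

lemma cost_add_scaleR:
  fixes v w :: "real ^ 'd \<Rightarrow> real ^ 'm"
  assumes "continuous_on K v" "continuous_on K w" "\<theta> \<in> meas_simplex K"
  shows "cost K (\<lambda>x. v x + t *\<^sub>R w x) \<theta> = cost K v \<theta> + t * cost K w \<theta>"
  using integrable_cost[OF K assms(3,1)] integrable_cost[OF K assms(3,2)]
  by (simp add: cost_def inner_add_right)

context
  fixes f :: "'m::finite \<Rightarrow> real ^ 'd \<Rightarrow> real ^ 'n" and \<alpha> :: "real ^ 'n"
  assumes f: "\<And>i. integrable (lebesgue_on K) (f i)" and ne: "admissible K f \<alpha> \<noteq> {}"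
begin

text \<open>The optimal value \<open>J\<close> is concave in the cost \<open>v\<close>; the following quantity is at most \<open>0\<close>,
  and it is \<open>o(t)\<close> exactly when \<open>J\<close> is differentiable at \<open>v\<close> in the direction \<open>w\<close>.\<close>

definition second_difference ::
  "(real ^ 'd \<Rightarrow> real ^ 'm) \<Rightarrow> (real ^ 'd \<Rightarrow> real ^ 'm) \<Rightarrow> real \<Rightarrow> real"
  where "second_difference w v t = optimal_value K f \<alpha> (\<lambda>x. v x + t *\<^sub>R w x)
    + optimal_value K f \<alpha> (\<lambda>x. v x + (- t) *\<^sub>R w x) - 2 * optimal_value K f \<alpha> v"

text \<open>By concavity, \<open>second_difference w v t / t\<close> can only grow as
  \<open>t\<close> shrinks, so one witness \<open>t\<close> controls all smaller ones; the
  intersection over \<epsilon> > 0 is differentiability at \<open>v\<close> along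
  \<open>w\<close>.\<close>

definition almost_smooth :: "(real ^ 'd \<Rightarrow> real ^ 'm) \<Rightarrow> real \<Rightarrow> (real ^ 'd \<Rightarrow> real ^ 'm) set"
  where "almost_smooth w \<epsilon> =
    {v \<in> mspace (cont_space K). \<exists>t>0. second_difference w v t > - \<epsilon> * t}"

lemma openin_almost_smooth:
  assumes w: "continuous_on K w"
  shows "openin (mtopology_of (cont_space K)) (almost_smooth w \<epsilon>)"
proof -
  interpret M: Metric_space "mspace (cont_space K)" "mdist (cont_space K)"
    by (rule Metric_space_mspace_mdist)
  let ?M = "measure lebesgue K"
  have "\<exists>r>0. M.mball v r \<subseteq> almost_smooth w \<epsilon>" if "v \<in> almost_smooth w \<epsilon>" for v
  proof -
    from that obtain t where v: "v \<in> mspace (cont_space K)"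
      and t: "t > 0" "second_difference w v t > - \<epsilon> * t"
      by (auto simp: almost_smooth_def)
    \<comment> \<open>Moving \<open>v\<close> by at most \<open>r\<close> changes each optimal value
      by at most \<open>r * ?M\<close>. The middle value counts twice, so the second difference
      loses at most four times that, less than its surplus over
      \<open>- \<epsilon> * t\<close>.\<close>
    define r where "r = (second_difference w v t + \<epsilon> * t) / (4 * (?M + 1))"
    have r: "r > 0" using t(2) by (simp add: r_def add_nonneg_pos)
    have rM: "4 * (r * ?M) < second_difference w v t + \<epsilon> * t"
    proof -
      have "4 * (r * ?M) < 4 * (r * (?M + 1))" using r by simp
      also have "\<dots> = second_difference w v t + \<epsilon> * t"
        using add_nonneg_pos[of ?M 1] by (simp add: r_def field_simps)
      finally show ?thesis .
    qed
    have "u \<in> almost_smooth w \<epsilon>" if "u \<in> M.mball v r" for u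
    proof -
      have u: "u \<in> mspace (cont_space K)" "mdist (cont_space K) v u < r"
        using that by (auto simp: M.mball_def)
      have uv: "norm (v x - u x) \<le> r" if "x \<in> K" for x
        using norm_le_mdist_cont_space[OF v u(1) that] u(2) by linarith
      have cont: "continuous_on K v" "continuous_on K u" using u(1) v by (auto simp: mspace_cont_space)
      have shift: "\<bar>optimal_value K f \<alpha> (\<lambda>x. v x + a *\<^sub>R w x) - optimal_value K f \<alpha> (\<lambda>x. u x + a *\<^sub>R w x)\<bar> \<le> r * ?M" for a
        using cont w uv by (intro optimal_value_lipschitz[OF ne] continuous_intros) auto
      have "\<bar>optimal_value K f \<alpha> v - optimal_value K f \<alpha> u\<bar> \<le> r * ?M"
        using cont uv by (intro optimal_value_lipschitz[OF ne])
      moreover have "- \<epsilon> * t < a' + b' - 2 * c'"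
        if "4 * m < a + b - 2 * c + \<epsilon> * t" "\<bar>a - a'\<bar> \<le> m" "\<bar>b - b'\<bar> \<le> m" "\<bar>c - c'\<bar> \<le> m"
        for a b c a' b' c' m :: real
        using that unfolding mult_minus_left by linarith
      ultimately have "second_difference w u t > - \<epsilon> * t"
        using rM shift[of t] shift[of "-t"] unfolding second_difference_def by blast
      then show ?thesis
        using u(1) t(1) by (auto simp: almost_smooth_def)
    qed
    then show ?thesis using r by blast
  qed
  then show ?thesis
    unfolding mtopology_of_def M.openin_mtopology by (auto simp: almost_smooth_def)
qed

text \<open>Along a line \<open>J\<close> is Lipschitz, so its second differences cannot be uniformly negative
  of first order.\<close>

lemma closure_of_almost_smooth:
  assumes w: "continuous_on K w" and "\<epsilon> > 0"
  shows "mtopology_of (cont_space K) closure_of almost_smooth w \<epsilon> = topspace (mtopology_of (cont_space K))"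
proof -
  interpret M: Metric_space "mspace (cont_space K)" "mdist (cont_space K)"
    by (rule Metric_space_mspace_mdist)
  obtain B where B: "\<And>x. x \<in> K \<Longrightarrow> norm (w x) \<le> B"
    using compact_imp_bounded[OF compact_continuous_image[OF w K]] by (auto simp: bounded_iff)
  have "\<exists>u\<in>almost_smooth w \<epsilon>. u \<in> M.mball v r" if v: "v \<in> mspace (cont_space K)" and "r > 0" for v r
  proof -
    have cv: "continuous_on K v" using v by (simp add: mspace_cont_space)
    have cvw: "continuous_on K (\<lambda>x. v x + s *\<^sub>R w x)" for s using cv w by (intro continuous_intros)
    define J where "J s = optimal_value K f \<alpha> (\<lambda>x. v x + s *\<^sub>R w x)" for s
    have lip: "\<bar>J a - J b\<bar> \<le> B * measure lebesgue K * \<bar>a - b\<bar>" for a b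
    proof -
      have "\<bar>J a - J b\<bar> \<le> (\<bar>a - b\<bar> * B) * measure lebesgue K"
        unfolding J_def
      proof (rule optimal_value_lipschitz[OF ne cvw cvw])
        show "norm (v x + a *\<^sub>R w x - (v x + b *\<^sub>R w x)) \<le> \<bar>a - b\<bar> * B" if "x \<in> K" for x
          using B[OF that] by (simp add: mult_left_mono flip: scaleR_diff_left)
      qed
      then show ?thesis by (simp add: mult_ac)
    qed
    \<comment> \<open>For \<open>0 \<le> s \<le> \<delta>\<close> the shifted cost
      \<open>v + s w\<close> stays within \<open>\<delta> * \<bar>B\<bar>\<close>, at most
      \<open>r / 2\<close>, of \<open>v\<close>. Only the centre \<open>s\<close> must be small;
      \<open>t\<close> may be any positive number.\<close>
    define \<delta> where "\<delta> = r / (2 * (\<bar>B\<bar> + 1))"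
    have "\<delta> > 0" using \<open>r > 0\<close> by (simp add: \<delta>_def add_nonneg_pos)
    have \<delta>B: "\<delta> * \<bar>B\<bar> < r"
    proof -
      have "\<delta> * \<bar>B\<bar> \<le> \<delta> * (\<bar>B\<bar> + 1)" using \<open>\<delta> > 0\<close> by simp
      also have "\<dots> = r / 2" using add_nonneg_pos[of "\<bar>B\<bar>" 1] by (simp add: \<delta>_def field_simps)
      finally show ?thesis using \<open>r > 0\<close> by simp
    qed
    obtain s t where st: "0 \<le> s" "s \<le> \<delta>" "t > 0" "J (s + t) + J (s - t) - 2 * J s > - \<epsilon> * t"
      using lipschitz_symmetric_difference[OF lip \<open>\<delta> > 0\<close> \<open>\<epsilon> > 0\<close>] by blast
    \<comment> \<open>The restriction makes the function extensional, hence a point of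
      \<open>cont_space K\<close>.\<close>
    define u where "u = restrict (\<lambda>x. v x + s *\<^sub>R w x) K"
    have "continuous_on K u"
      using cvw[of s] by (rule continuous_on_eq) (simp add: u_def)
    then have u: "u \<in> mspace (cont_space K)" by (simp add: mspace_cont_space u_def)
    have J_eq: "optimal_value K f \<alpha> (\<lambda>x. u x + a *\<^sub>R w x) = J (s + a)" for a
      unfolding J_def by (rule optimal_value_cong) (simp add: u_def scaleR_add_left)
    have "second_difference w u t > - \<epsilon> * t"
      using st(4) J_eq[of t] J_eq[of "-t"] J_eq[of 0] by (simp add: second_difference_def)
    then have "u \<in> almost_smooth w \<epsilon>" using u st(3) by (auto simp: almost_smooth_def)
    moreover have "mdist (cont_space K) v u \<le> \<delta> * \<bar>B\<bar>"
    proof (rule mdist_cont_space_le)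
      show "norm (v x - u x) \<le> \<delta> * \<bar>B\<bar>" if "x \<in> K" for x
        using B[OF that] st(1,2) that by (auto simp: u_def intro!: mult_mono)
    qed (use \<open>\<delta> > 0\<close> in simp)
    ultimately show ?thesis
      using u v \<delta>B by (intro bexI[of _ u]) (auto simp: M.mball_def)
  qed
  then show ?thesis
    unfolding topspace_mtopology_of mtopology_of_def M.metric_closure_of by auto
qed

text \<open>Crosswise testing: \<theta> bounds the optimal value at \<open>v + t w\<close> from
  above and \<eta> the one at \<open>v - t w\<close>. In the sum the value at \<open>v\<close>
  cancels, leaving \<open>t\<close> times the difference of the two costs against
  \<open>w\<close>.\<close>

lemma almost_smooth_solutions_close:
  assumes w: "continuous_on K w" and v: "v \<in> almost_smooth w \<epsilon>"
    and sol: "is_solution K f \<alpha> v \<theta>" "is_solution K f \<alpha> v \<eta>"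
  shows "cost K w \<eta> - cost K w \<theta> < \<epsilon>"
proof -
  from v obtain t where t: "t > 0" "second_difference w v t > - \<epsilon> * t"
    by (auto simp: almost_smooth_def)
  have cv: "continuous_on K v" using v by (simp add: almost_smooth_def mspace_cont_space)
  have adm: "\<theta> \<in> admissible K f \<alpha>" "\<eta> \<in> admissible K f \<alpha>"
    using sol by (auto simp: is_solution_def)
  have cvw: "continuous_on K (\<lambda>x. v x + s *\<^sub>R w x)" for s using cv w by (intro continuous_intros)
  have "optimal_value K f \<alpha> (\<lambda>x. v x + t *\<^sub>R w x) \<le> optimal_value K f \<alpha> v + t * cost K w \<theta>"
    using optimal_value_le[OF cvw adm(1), of t] cost_add_scaleR[OF cv w, of \<theta> t] adm(1)
      optimal_value_eq_cost[OF sol(1)] by (simp add: admissible_def)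
  moreover have "optimal_value K f \<alpha> (\<lambda>x. v x + (- t) *\<^sub>R w x) \<le> optimal_value K f \<alpha> v + (- t) * cost K w \<eta>"
    using optimal_value_le[OF cvw adm(2), of "- t"] cost_add_scaleR[OF cv w, of \<eta> "- t"] adm(2)
      optimal_value_eq_cost[OF sol(2)] by (simp add: admissible_def)
  ultimately have "- \<epsilon> * t < t * cost K w \<theta> + (- t) * cost K w \<eta>"
    using t(2) unfolding second_difference_def by linarith
  then have "t * (cost K w \<eta> - cost K w \<theta>) < t * \<epsilon>" by (simp add: algebra_simps)
  then show ?thesis using t(1) by simp
qed

lemma residual_uniquely_solvable:
  "residual_in (mtopology_of (cont_space K)) (uniquely_solvable K f \<alpha>)"
proof -
  have KS: "K \<in> sets lebesgue" using K by (simp add: fmeasurableD lmeasurable_compact)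
  obtain G :: "(real ^ 'd \<Rightarrow> real) set" where G: "countable G" "\<forall>g\<in>G. continuous_on UNIV g"
    and separating: "\<forall>h. integrable (lebesgue_on K) h \<longrightarrow> (\<forall>g\<in>G. (\<integral>x. g x * h x \<partial>lebesgue_on K) = 0)
      \<longrightarrow> (AE x in lebesgue_on K. h x = 0)"
    using countable_separating_continuous[OF KS] by blast
  \<comment> \<open>The cost of a control against \<open>w g i\<close> is the integral of
    \<open>g\<close> times its component \<open>i\<close>, so equal costs in these directions let
    the separating family act on each component.\<close>
  define w where "w g i = (\<lambda>x. g x *\<^sub>R axis i 1 :: real ^ 'm)" for g :: "real ^ 'd \<Rightarrow> real" and i
  have cw: "continuous_on K (w g i)" if "g \<in> G" for g i
    unfolding w_def using continuous_on_subset[OF G(2)[rule_format, OF that]] by (intro continuous_intros) auto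
  define \<U> where "\<U> = (\<lambda>(g, i, n). almost_smooth (w g i) (1 / real (Suc n))) ` (G \<times> UNIV \<times> UNIV)"
  have "countable \<U>"
    unfolding \<U>_def using G(1) by (intro countable_image countable_SIGMA) (auto intro: countable_finite)
  moreover have "openin (mtopology_of (cont_space K)) U
      \<and> mtopology_of (cont_space K) closure_of U = topspace (mtopology_of (cont_space K))" if "U \<in> \<U>" for U
    using that unfolding \<U>_def by (auto intro!: openin_almost_smooth closure_of_almost_smooth cw simp del: topspace_mtopology_of)
  moreover have "v \<in> uniquely_solvable K f \<alpha>" if v: "v \<in> mspace (cont_space K)" and v\<U>: "v \<in> \<Inter>\<U>" for v
  proof -
    obtain \<theta> where \<theta>: "is_solution K f \<alpha> v \<theta>"
      using exists_solution[OF K f ne] v by (auto simp: mspace_cont_space)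
    have "AE x in lebesgue_on K. \<eta> x = \<theta> x" if \<eta>: "is_solution K f \<alpha> v \<eta>" for \<eta>
    proof -
      have ms: "\<theta> \<in> meas_simplex K" "\<eta> \<in> meas_simplex K"
        using \<theta> \<eta> by (auto simp: is_solution_def admissible_def)
      have eq: "cost K (w g i) \<eta> = cost K (w g i) \<theta>" if "g \<in> G" for g i
      proof -
        have smooth: "v \<in> almost_smooth (w g i) (1 / real (Suc n))" for n
          using v\<U> that by (force simp: \<U>_def)
        have "\<bar>cost K (w g i) \<eta> - cost K (w g i) \<theta>\<bar> \<le> 1 / real (Suc n)" for n
          using almost_smooth_solutions_close[OF cw[OF that] smooth[of n] \<theta> \<eta>]
            almost_smooth_solutions_close[OF cw[OF that] smooth[of n] \<eta> \<theta>] by linarith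
        then have "\<bar>cost K (w g i) \<eta> - cost K (w g i) \<theta>\<bar> \<le> 0"
          using nat_approx_posE by (meson not_le)
        then show ?thesis by simp
      qed
      have "AE x in lebesgue_on K. \<eta> x $ i - \<theta> x $ i = 0" for i
      proof (rule separating[rule_format])
        have "integrable (lebesgue_on K) (\<lambda>x. \<zeta> x $ i)" if "\<zeta> \<in> meas_simplex K" for \<zeta> :: "real ^ 'd \<Rightarrow> real ^ 'm"
          using integrable_cost[OF K that continuous_on_const[of K "axis i 1"]] by (simp add: inner_axis)
        then show "integrable (lebesgue_on K) (\<lambda>x. \<eta> x $ i - \<theta> x $ i)"
          using ms by auto
        show "(\<integral>x. g x * (\<eta> x $ i - \<theta> x $ i) \<partial>lebesgue_on K) = 0" if "g \<in> G" for g
          using eq[OF that, of i] integrable_cost[OF K ms(1) cw[OF that, of i]]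
            integrable_cost[OF K ms(2) cw[OF that, of i]]
          by (simp add: cost_def w_def inner_axis right_diff_distrib)
      qed
      then have "AE x in lebesgue_on K. \<forall>i. \<eta> x $ i - \<theta> x $ i = 0"
        by (rule eventually_all_finite)
      then show ?thesis by eventually_elim (simp add: vec_eq_iff)
    qed
    then show ?thesis using v \<theta> by (auto simp: uniquely_solvable_def)
  qed
  ultimately show ?thesis
    unfolding residual_in_def by (intro conjI exI[of _ \<U>]) (auto simp: uniquely_solvable_def)
qed

end

end

theorem theorem1:
  fixes K :: "(real ^ 'd) set"
    and f :: "'m::finite \<Rightarrow> real ^ 'd \<Rightarrow> real ^ 'n"
    and \<theta>bar :: "real ^ 'd \<Rightarrow> real ^ 'm"
    and \<alpha> :: "real ^ 'n"
  assumes "compact K"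
    and "\<And>i. integrable (lebesgue_on K) (f i)"
    and "\<theta>bar \<in> meas_simplex K"
    and "\<alpha> = mixed_integral K f \<theta>bar"
  shows "residual_in (mtopology_of (cont_space K)) (uniquely_solvable K f \<alpha>) \<and>
    (\<forall>v\<in>uniquely_solvable K f \<alpha>. \<forall>\<theta>. is_solution K f \<alpha> v \<theta> \<longrightarrow>
      (AE x in lebesgue_on K. \<theta> x extreme_point_of (std_simplex :: (real ^ 'm) set)))"
proof (intro conjI ballI allI impI)
  have "admissible K f \<alpha> \<noteq> {}"
    using assms(3,4) by (auto simp: admissible_def)
  then show "residual_in (mtopology_of (cont_space K)) (uniquely_solvable K f \<alpha>)"
    by (rule residual_uniquely_solvable[OF assms(1,2)])
next
  fix v \<theta>
  assume v: "v \<in> uniquely_solvable K f \<alpha>" and sol: "is_solution K f \<alpha> v \<theta>"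
  have "AE x in lebesgue_on K. \<eta> x = \<theta> x" if \<eta>: "is_solution K f \<alpha> v \<eta>" for \<eta>
  proof -
    \<comment> \<open>The solution witnessing uniqueness need not be the given one; any two
      solutions are compared through it.\<close>
    obtain \<theta>' where "\<And>\<xi>. is_solution K f \<alpha> v \<xi> \<Longrightarrow> AE x in lebesgue_on K. \<xi> x = \<theta>' x"
      using v by (auto simp: uniquely_solvable_def)
    from this[OF \<eta>] this[OF sol] show ?thesis by eventually_elim simp
  qed
  moreover have "continuous_on K v"
    using v mspace_cont_space[OF assms(1)] by (auto simp: uniquely_solvable_def)
  ultimately show "AE x in lebesgue_on K. \<theta> x extreme_point_of (std_simplex :: (real ^ 'm) set)"
    using unique_solution_extreme[OF assms(1,2) _ sol] by blast
qed

end
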